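(* Let $\mathcal{X}$ be a spectrally positive pregenerator, continuous at zero, satisfying $$\mathcal{X}f(x)=R(x)\,\mathrm{L}^{\Psi}f(x),\qquad x\in[0,\infty),\ f\in\mathcal{D},$$ for some $\Psi\in\mathsf{pk\text{-}spLp}$ and some measurable function $R:[0,\infty)\to[0,\infty)$, neither identically zero. Then, for $\mathcal{X}$ to be in Laplace duality with some spectrally positive pregenerator $\mathcal{Y}$ that is continuous at zero, it is necessary and sufficient that: (i) in case $\Psi\ge0$: $\Psi=\Sigma$ and $R=\hat\Sigma$ for some $\{\Sigma,\hat\Sigma\}\subset\mathsf{spLp}_{\neg\uparrow}$ and $$(\mathcal{Y}\mathsf{e}_x)(y)=\Sigma(y)\,(\mathrm{L}^{\hat\Sigma}\mathsf{e}_x)(y),\qquad x\in(0,\infty),\ y\in[0,\infty);$$ (ii) in case $\Psi\le0$: $\Psi=-\Phi$ and $R=\hat\Phi$ for some $\{\Phi,\hat\Phi\}\subset\mathsf{pk\text{-}subo}$ and $$(\mathcal{Y}\mathsf{e}_x)(y)=\Phi(y)\,(\mathrm{L}^{-\hat\Phi}\mathsf{e}_x)(y),\qquad x\in(0,\infty),\ y\in[0,\infty);$$ (iii) otherwise: $R=\gamma\,\mathrm{id}_{[0,\infty)}$ for some $\gamma\in(0,\infty)$ and $$(\mathcal{Y}\mathsf{e}_x)(y)=-\Psi(y)\,(\mathrm{L}^{-\gamma\,\mathrm{id}_{[0,\infty)}}\mathsf{e}_x)(y),\qquad x\in(0,\infty),\ y\in[0,\infty).$$ At the level of the Laplace symbols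 $\psi$ and $\hat\psi$ to which $\mathcal{X}$ and $\mathcal{Y}$ are respectively associated, for $x,y\in(0,\infty)$: in case (i), $\psi(x,y)=\hat\Sigma(x)\Sigma(y)$; in case (ii), $\psi(x,y)=-\hat\Phi(x)\Phi(y)$; in case (iii), $\psi(x,y)=\gamma x\Psi(y)$.
   Context: Function classes on $[0,\infty)$ (with $a,d,c\in[0,\infty)$, $b\in\mathbb{R}$, $\nu$ a measure on the Borel sets of $(0,\infty)$): - $\mathsf{pk\text{-}spLp}$: all $\Psi(y)=\int(e^{-uy}-1+uy\mathbf{1}_{(0,1]}(u))\nu(\mathrm{d}u)+ay^2-by-c$ with $\int1\wedge u^2\,\nu(\mathrm{d}u)<\infty$; - $\mathsf{pk\text{-}subo}$: all $\Phi(y)=\int(1-e^{-uy})\nu(\mathrm{d}u)+dy+c$ with $\int1\wedge u\,\nu(\mathrm{d}u)<\infty$; - $\mathsf{spLp}_{\neg\uparrow}$: all $\Sigma(y)=\int(e^{-uy}-1+uy)\nu(\mathrm{d}u)+ay^2+dy$ with $\int u\wedge u^2\,\nu(\mathrm{d}u)<\infty$ (equivalently, the nonnegative members of $\mathsf{pk\text{-}spLp}$). One has $-\mathsf{pk\text{-}subo}\subset\mathsf{pk\text{-}spLp}$. For $x,y\in(0,\infty)$ put $\mathsf{e}^y(u)=e^{-uy}$, $\mathsf{e}_x(v)=e^{-xv}$ on $[0,\infty]$ (value $0$ at $\infty$), and let $\mathcal{D}$ be the linear span of $\{\mathsf{e}^y:y\in(0,\infty)\}$. For $\Psi\in\mathsf{pk\text{-}spLp}$,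 $\mathrm{L}^\Psi$ is the linear operator on $\mathcal{D}$ with $\mathrm{L}^\Psi\mathsf{e}^y(x)=\Psi(y)e^{-xy}$ for $(x,y)\in[0,\infty]\times(0,\infty)$. A spectrally positive pregenerator is a linear operator $\mathcal{X}$ on $\mathcal{D}$, returning real functions on $[0,\infty]$, of the following form: for $f\in\mathcal{D}$, $(\mathcal{X}f)(\infty)=0$, $$(\mathcal{X}f)(0)=\int(f(u)-f(0))\nu_0(\mathrm{d}u)+d_0f'(0)-c_0f(0),$$ $$(\mathcal{X}f)(x)=\int\big(f(x+u)-f(x)-uf'(x)\mathbf{1}_{(0,1]}(u)\big)\nu_x(\mathrm{d}u)+a_xf''(x)+b_xf'(x)-c_xf(x),\quad x\in(0,\infty),$$ where $\nu_0,\nu_x$ are measures on $(0,\infty)$ with $\int1\wedge u\,\nu_0(\mathrm{d}u)<\infty$, $\int1\wedge u^2\,\nu_x(\mathrm{d}u)<\infty$, $d_0,c_0,a_x,c_x\in[0,\infty)$, $b_x\in\mathbb{R}$, and $x\mapsto(\nu_x,a_x,b_x,c_x)$ is measurable on $(0,\infty)$ (i.e. $a_x,b_x,c_x$ and $x\mapsto\int g(u)(1\wedge u^2)\nu_x(\mathrm{d}u)$ are Borel for each bounded Borel $g$). Its associated Laplace symbol is $\psi(x,y)=e^{xy}(\mathcal{X}\mathsf{e}^y)(x)$ for $x\in[0,\infty)$, $\psi(\infty,y)=0$, $y\in(0,\infty)$. It is continuous at zero if $\mathcal{X}f$ is continuous at $0$ for all $f\in\mathcal{D}$. Pregenerators $\mathcal{X}$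 and $\mathcal{Y}$ are in Laplace duality if $(\mathcal{X}\mathsf{e}^y)(x)=(\mathcal{Y}\mathsf{e}_x)(y)$ for all $x,y\in(0,\infty)$. *)

theory Defs
  imports "HOL-Analysis.Analysis"
begin

text \<open>Members of the classes below are functions on all reals of which only the values on \<open>[0,\<infinity>)\<close> are constrained;
  equality of two such functions is accordingly to be stated on \<open>[0,\<infinity>)\<close>.
  Since the functions \<open>min 1 u\<close>, \<open>min 1 (u\<^sup>2)\<close> and \<open>min u (u\<^sup>2)\<close> are nonnegative and Borel
  on \<open>(0,\<infinity>)\<close>, their integrability means finiteness of the integral.\<close>

definition pos_borel :: "real measure" where
  "pos_borel = restrict_space borel {0<..}"

definition pk_spLp :: "(real \<Rightarrow> real) set" where
  "pk_spLp = {\<Psi>. \<exists>\<nu> a b c. sets \<nu> = sets pos_borel \<and> integrable \<nu> (\<lambda>u. min 1 (u\<^sup>2))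
      \<and> 0 \<le> a \<and> 0 \<le> c
      \<and> (\<forall>y\<ge>0. \<Psi> y = (\<integral>u. (exp (- (u * y)) - 1 + u * y * indicator {0<..1} u) \<partial>\<nu>)
            + a * y\<^sup>2 - b * y - c)}"

definition pk_subo :: "(real \<Rightarrow> real) set" where
  "pk_subo = {\<Phi>. \<exists>\<nu> d c. sets \<nu> = sets pos_borel \<and> integrable \<nu> (\<lambda>u. min 1 u)
      \<and> 0 \<le> d \<and> 0 \<le> c
      \<and> (\<forall>y\<ge>0. \<Phi> y = (\<integral>u. (1 - exp (- (u * y))) \<partial>\<nu>) + d * y + c)}"

definition spLp_nonup :: "(real \<Rightarrow> real) set" where
  "spLp_nonup = {\<Sigma>. \<exists>\<nu> a d. sets \<nu> = sets pos_borel \<and> integrable \<nu> (\<lambda>u. min u (u\<^sup>2))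
      \<and> 0 \<le> a \<and> 0 \<le> d
      \<and> (\<forall>y\<ge>0. \<Sigma> y = (\<integral>u. (exp (- (u * y)) - 1 + u * y) \<partial>\<nu>) + a * y\<^sup>2 + d * y)}"

definition expo :: "real \<Rightarrow> ennreal \<Rightarrow> real" where
  "expo y u = (if u = \<infinity> then 0 else exp (- (enn2real u * y)))"

definition expo_comb :: "real set \<Rightarrow> (real \<Rightarrow> real) \<Rightarrow> ennreal \<Rightarrow> real" where
  "expo_comb S k = (\<lambda>u. \<Sum>y\<in>S. k y * expo y u)"

definition expo_span :: "(ennreal \<Rightarrow> real) set" where
  "expo_span = {f. \<exists>S k. finite S \<and> S \<subseteq> {0<..} \<and> f = expo_comb S k}"

text \<open>The description below determines a unique function for each member of the span because the
  exponentials are linearly independent; see \<open>L_op_expo_comb\<close>.\<close>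

definition L_op :: "(real \<Rightarrow> real) \<Rightarrow> (ennreal \<Rightarrow> real) \<Rightarrow> ennreal \<Rightarrow> real" where
  "L_op \<Psi> f = (THE g. \<exists>S k. finite S \<and> S \<subseteq> {0<..} \<and> f = expo_comb S k
                  \<and> g = expo_comb S (\<lambda>y. \<Psi> y * k y))"

lemma exp_lin_indep:
  fixes S :: "real set" and k :: "real \<Rightarrow> real"
  assumes "finite S" and "\<And>t. 0 \<le> t \<Longrightarrow> (\<Sum>y\<in>S. k y * exp (- (t * y))) = 0"
  shows "\<forall>y\<in>S. k y = 0"
  using assms
proof (induction S rule: finite_linorder_min_induct)
  case empty
  then show ?case by simp
next
  case (insert b A)
  have nb: "b \<notin> A" using insert.hyps by auto
  have eq: "k b + (\<Sum>y\<in>A. k y * exp (- (t * (y - b)))) = 0" if "0 \<le> t" for t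
  proof -
    have "(k b * exp (- (t * b)) + (\<Sum>y\<in>A. k y * exp (- (t * y)))) * exp (t * b) = 0"
      using insert.prems[OF that] insert.hyps nb by simp
    moreover have "(k b * exp (- (t * b)) + (\<Sum>y\<in>A. k y * exp (- (t * y)))) * exp (t * b)
        = k b + (\<Sum>y\<in>A. k y * exp (- (t * (y - b))))"
    proof -
      have "exp (- (t * y)) * exp (t * b) = exp (- (t * (y - b)))" for y
        by (simp add: exp_add[symmetric] algebra_simps)
      then show ?thesis
        by (simp add: distrib_right sum_distrib_right mult.assoc)
    qed
    ultimately show ?thesis by simp
  qed
  have lim: "((\<lambda>t. k b + (\<Sum>y\<in>A. k y * exp (- (t * (y - b))))) \<longlongrightarrow> k b + (\<Sum>y\<in>A. k y * 0)) at_top"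
  proof (intro tendsto_intros)
    fix y assume "y \<in> A"
    then have "y - b > 0" using insert.hyps by auto
    then have "filterlim (\<lambda>t. t * (y - b)) at_top at_top"
      by (intro filterlim_at_top_mult_tendsto_pos[OF tendsto_const _ filterlim_ident]) auto
    then have "filterlim (\<lambda>t. - (t * (y - b))) at_bot at_top"
      by (simp add: filterlim_uminus_at_bot)
    then show "((\<lambda>t. exp (- (t * (y - b)))) \<longlongrightarrow> 0) at_top"
      by (rule filterlim_compose[OF exp_at_bot])
  qed
  have "\<forall>\<^sub>F t in at_top. k b + (\<Sum>y\<in>A. k y * exp (- (t * (y - b)))) = 0"
    using eq by (intro eventually_mono[OF eventually_ge_at_top[of 0]]) auto
  then have "((\<lambda>t. k b + (\<Sum>y\<in>A. k y * exp (- (t * (y - b))))) \<longlongrightarrow> 0) at_top"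
    by (rule tendsto_eventually)
  from tendsto_unique[OF _ lim this] have kb: "k b = 0" by simp
  have "(\<Sum>y\<in>A. k y * exp (- (t * y))) = 0" if "0 \<le> t" for t
    using insert.prems[OF that] insert.hyps nb kb by simp
  then show ?case using insert.IH kb by auto
qed

lemma expo_comb_extend:
  assumes "finite U" "S \<subseteq> U"
  shows "expo_comb S k = expo_comb U (\<lambda>y. if y \<in> S then k y else 0)"
  unfolding expo_comb_def
  by (rule ext, rule sum.mono_neutral_cong_left) (use assms in auto)

lemma L_op_expo_comb:
  assumes "finite S" "S \<subseteq> {0<..}"
  shows "L_op \<Psi> (expo_comb S k) = expo_comb S (\<lambda>y. \<Psi> y * k y)"
  unfolding L_op_def
proof (rule the_equality)
  show "\<exists>S' k'. finite S' \<and> S' \<subseteq> {0<..} \<and> expo_comb S k = expo_comb S' k'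
      \<and> expo_comb S (\<lambda>y. \<Psi> y * k y) = expo_comb S' (\<lambda>y. \<Psi> y * k' y)"
    using assms by blast
next
  fix g
  assume "\<exists>T l. finite T \<and> T \<subseteq> {0<..} \<and> expo_comb S k = expo_comb T l
      \<and> g = expo_comb T (\<lambda>y. \<Psi> y * l y)"
  then obtain T l where T: "finite T" and eq: "expo_comb S k = expo_comb T l"
    and g: "g = expo_comb T (\<lambda>y. \<Psi> y * l y)" by blast
  define U where "U = S \<union> T"
  have U: "finite U" "S \<subseteq> U" "T \<subseteq> U" using assms T by (auto simp: U_def)
  let ?k = "\<lambda>y. if y \<in> S then k y else 0" and ?l = "\<lambda>y. if y \<in> T then l y else 0"
  have e: "expo_comb U ?k = expo_comb U ?l"
    using eq expo_comb_extend[OF U(1,2)] expo_comb_extend[OF U(1,3)] by metis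
  have "(\<Sum>y\<in>U. (?k y - ?l y) * exp (- (t * y))) = 0" if "0 \<le> t" for t
    using fun_cong[OF e, of "ennreal t"] that
    by (simp add: expo_comb_def expo_def left_diff_distrib sum_subtractf)
  from exp_lin_indep[OF U(1) this] have kl: "\<forall>y\<in>U. ?k y = ?l y" by auto
  have "g = expo_comb U (\<lambda>y. if y \<in> T then \<Psi> y * l y else 0)"
    unfolding g by (rule expo_comb_extend[OF U(1,3)])
  also have "\<dots> = expo_comb U (\<lambda>y. if y \<in> S then \<Psi> y * k y else 0)"
    unfolding expo_comb_def using kl by (intro ext sum.cong) (auto split: if_splits)
  also have "\<dots> = expo_comb S (\<lambda>y. \<Psi> y * k y)"
    by (rule expo_comb_extend[OF U(1,2), symmetric])
  finally show "g = expo_comb S (\<lambda>y. \<Psi> y * k y)" .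
qed

lemma expo_eq_comb: "expo y = expo_comb {y} (\<lambda>_. 1)"
  by (simp add: expo_comb_def)

lemma L_op_expo: "0 < y \<Longrightarrow> L_op \<Psi> (expo y) x = \<Psi> y * expo y x"
  unfolding expo_eq_comb[of y] by (subst L_op_expo_comb) (auto simp: expo_comb_def)

text \<open>An operator on the span is a function on all of \<open>ennreal \<Rightarrow> real\<close> whose values
  outside \<open>expo_span\<close> are irrelevant; linearity on the span is a consequence of the form.
  The derivative at \<open>0\<close> is one-sided.\<close>

definition sp_pregenerator :: "((ennreal \<Rightarrow> real) \<Rightarrow> ennreal \<Rightarrow> real) \<Rightarrow> bool" where
  "sp_pregenerator X \<longleftrightarrow>
    (\<exists>(\<nu>0 :: real measure) (d0 :: real) (c0 :: real)
      (\<nu> :: real \<Rightarrow> real measure) (a :: real \<Rightarrow> real) (b :: real \<Rightarrow> real) (c :: real \<Rightarrow> real).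
      sets \<nu>0 = sets pos_borel \<and> integrable \<nu>0 (\<lambda>u. min 1 u) \<and> 0 \<le> d0 \<and> 0 \<le> c0
    \<and> (\<forall>x>0. sets (\<nu> x) = sets pos_borel \<and> integrable (\<nu> x) (\<lambda>u. min 1 (u\<^sup>2))
           \<and> 0 \<le> a x \<and> 0 \<le> c x)
    \<and> a \<in> borel_measurable pos_borel \<and> b \<in> borel_measurable pos_borel
    \<and> c \<in> borel_measurable pos_borel
    \<and> (\<forall>g \<in> borel_measurable pos_borel. bounded (g ` {0<..}) \<longrightarrow>
          (\<lambda>x. \<integral>u. g u * min 1 (u\<^sup>2) \<partial>\<nu> x) \<in> borel_measurable pos_borel)
    \<and> (\<forall>f \<in> expo_span.
          X f \<infinity> = 0
        \<and> X f 0 = (\<integral>u. (f (ennreal u) - f 0) \<partial>\<nu>0)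
            + d0 * vector_derivative (\<lambda>t. f (ennreal t)) (at 0 within {0..}) - c0 * f 0
        \<and> (\<forall>x>0. X f (ennreal x) =
              (\<integral>u. (f (ennreal (x + u)) - f (ennreal x)
                     - u * deriv (\<lambda>t. f (ennreal t)) x * indicator {0<..1} u) \<partial>\<nu> x)
            + a x * deriv (deriv (\<lambda>t. f (ennreal t))) x
            + b x * deriv (\<lambda>t. f (ennreal t)) x
            - c x * f (ennreal x))))"

definition continuous_at_zero :: "((ennreal \<Rightarrow> real) \<Rightarrow> ennreal \<Rightarrow> real) \<Rightarrow> bool" where
  "continuous_at_zero X \<longleftrightarrow> (\<forall>f \<in> expo_span. isCont (X f) 0)"

definition laplace_symbol ::
    "((ennreal \<Rightarrow> real) \<Rightarrow> ennreal \<Rightarrow> real) \<Rightarrow> ennreal \<Rightarrow> real \<Rightarrow> real" where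
  "laplace_symbol X x y = (if x = \<infinity> then 0 else exp (enn2real x * y) * X (expo y) x)"

definition laplace_dual ::
    "((ennreal \<Rightarrow> real) \<Rightarrow> ennreal \<Rightarrow> real) \<Rightarrow>
     ((ennreal \<Rightarrow> real) \<Rightarrow> ennreal \<Rightarrow> real) \<Rightarrow> bool" where
  "laplace_dual X Y \<longleftrightarrow>
    (\<forall>x>0. \<forall>y>0. X (expo y) (ennreal x) = Y (expo x) (ennreal y))"

end

theory Submission
  imports Defs "HOL-Real_Asymp.Real_Asymp"
begin

text \<open>
  Since \<open>X (expo y)\<close> has the value \<open>R x * \<Psi> y * exp (- x y)\<close> at \<open>x\<close>, an operator \<open>Y\<close> is dual to \<open>X\<close> iff
  its symbol at \<open>y\<close> is the function \<open>\<Psi> y * R\<close> for every \<open>y > 0\<close>. For a pregenerator this symbol is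
  an exponent, that is, a member of \<open>pk_spLp\<close>, and exponents form a cone. Hence a dual exists only
  if \<open>R\<close> is an exponent (when \<open>\<Psi>\<close> takes a positive value) and \<open>- R\<close> is an exponent (when \<open>\<Psi>\<close> takes a
  negative value); see \<open>dual_multiplier_exponent\<close>. Continuity at zero transfers all these identities
  to the state \<open>0\<close>.

  The classification of \<open>R\<close> then rests on three facts on exponents. A nonnegative one lies in
  \<open>spLp_nonup\<close> and a nonpositive one in \<open>- pk_subo\<close>: dividing by the argument and letting it tend to
  \<open>0\<close>, respectively to \<open>\<infinity>\<close>, Fatou's lemma shows that the large, respectively the small, jumps have a
  finite mean which the drift compensates (\<open>pk_spLp_nonneg_imp_spLp_nonup\<close>,
  \<open>pk_spLp_nonpos_imp_pk_subo\<close>). If both \<open>R\<close> and \<open>- R\<close> are exponents, then \<open>R\<close> is convex and concave,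
  hence affine (\<open>pk_spLp_both_signs_affine\<close>). In the last case moreover \<open>R 0 = 0\<close>, because the
  symbol \<open>R 0 * \<Psi>\<close> of \<open>X\<close> at the state \<open>0\<close> is nonpositive whereas \<open>\<Psi>\<close> takes a positive value.

  Conversely, the operator \<open>f \<mapsto> s * L_op T f\<close> with \<open>s = \<Psi>\<close>, \<open>T = R\<close> or with \<open>s = - \<Psi>\<close>, \<open>T = - R\<close> has the
  required symbol. It is a pregenerator if \<open>s \<ge> 0\<close>, by scaling the characteristics of \<open>T\<close> with \<open>s\<close>, and
  also if \<open>T\<close> is linear, because a drift may have either sign at interior states
  (\<open>product_op_pregenerator_nonneg\<close>, \<open>product_op_pregenerator_drift\<close>). The boundary condition at the
  state \<open>0\<close>, that \<open>- \<Psi> 0 * R\<close> be in \<open>pk_subo\<close>, holds because \<open>\<Psi> 0 \<le> 0\<close>, with equality if \<open>\<Psi> \<ge> 0\<close>.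
\<close>

section \<open>Integrals of the Levy-Khintchine kernel\<close>

text \<open>The integrand \<open>exp (- u y) - 1 + u y\<close> of an exponent, compensated on \<open>(0,1]\<close> only. The
  argument \<open>y\<close> of the exponent comes first, so that \<open>lk_kernel y\<close> is the function to integrate.\<close>

definition lk_kernel :: "real \<Rightarrow> real \<Rightarrow> real" where
  "lk_kernel y u = exp (- (u * y)) - 1 + u * y * indicator {0<..1} u"

text \<open>The exponent with jump measure \<open>\<nu>\<close>, Gaussian coefficient \<open>a\<close>, drift \<open>b\<close> and killing rate \<open>c\<close>;
  drift and killing enter with a minus sign.\<close>

definition lk_exponent :: "real measure \<Rightarrow> real \<Rightarrow> real \<Rightarrow> real \<Rightarrow> real \<Rightarrow> real" where
  "lk_exponent \<nu> a b c y = (\<integral>u. lk_kernel y u \<partial>\<nu>) + a * y\<^sup>2 - b * y - c"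

text \<open>Admissible jump measures on the Borel sets of \<open>(0,\<infinity>)\<close>.\<close>

definition levy_measure :: "real measure \<Rightarrow> bool" where
  "levy_measure \<nu> \<longleftrightarrow> sets \<nu> = sets pos_borel \<and> integrable \<nu> (\<lambda>u. min 1 (u\<^sup>2))"

lemma pk_spLp_iff:
  "\<Psi> \<in> pk_spLp \<longleftrightarrow>
    (\<exists>\<nu> a b c. levy_measure \<nu> \<and> 0 \<le> a \<and> 0 \<le> c \<and> (\<forall>y\<ge>0. \<Psi> y = lk_exponent \<nu> a b c y))"
  unfolding pk_spLp_def levy_measure_def lk_exponent_def lk_kernel_def
  by (simp only: mem_Collect_eq conj_assoc)

lemma space_pos_borel: "sets \<nu> = sets pos_borel \<Longrightarrow> space \<nu> = {0<..}"
  by (drule sets_eq_imp_space_eq) (simp add: pos_borel_def space_restrict_space)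

lemma borel_measurable_pos:
  assumes "sets \<nu> = sets pos_borel" "f \<in> borel_measurable borel"
  shows "f \<in> borel_measurable \<nu>"
  using measurable_restrict_space1[OF assms(2), of "{0<..}"] assms(1)
  by (simp add: pos_borel_def cong: measurable_cong_sets)

lemma integrable_pos_bound:
  fixes f w :: "real \<Rightarrow> real"
  assumes "sets \<nu> = sets pos_borel" "integrable \<nu> w" "f \<in> borel_measurable borel"
    and "\<And>u. 0 < u \<Longrightarrow> \<bar>f u\<bar> \<le> C * w u"
  shows "integrable \<nu> f"
proof (rule Bochner_Integration.integrable_bound)
  show "integrable \<nu> (\<lambda>u. C * w u)" using assms(2) by simp
  show "f \<in> borel_measurable \<nu>" by (rule borel_measurable_pos[OF assms(1,3)])
  show "AE u in \<nu>. norm (f u) \<le> norm (C * w u)"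
  proof (rule AE_I2)
    fix u assume "u \<in> space \<nu>"
    then have "0 < u" using space_pos_borel[OF assms(1)] by simp
    from assms(4)[OF this] show "norm (f u) \<le> norm (C * w u)" by simp
  qed
qed

lemma exp_minus_taylor_bounds:
  fixes t :: real
  assumes "0 \<le> t"
  shows "0 \<le> exp (- t) - 1 + t" "exp (- t) - 1 + t \<le> t\<^sup>2"
proof -
  show "0 \<le> exp (- t) - 1 + t" using exp_ge_add_one_self[of "- t"] by simp
  have "exp (- t) = 1 / exp t" by (simp add: exp_minus inverse_eq_divide)
  also have "\<dots> \<le> 1 / (1 + t)"
    using exp_ge_add_one_self[of t] assms by (intro divide_left_mono) auto
  also have "\<dots> \<le> 1 - t + t\<^sup>2"
  proof -
    have "(1 - t + t\<^sup>2) * (1 + t) = 1 + t ^ 3"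
      by (simp add: algebra_simps power2_eq_square power3_eq_cube)
    moreover have "0 \<le> t ^ 3" using assms by simp
    ultimately have "1 \<le> (1 - t + t\<^sup>2) * (1 + t)" by linarith
    then show ?thesis using assms by (subst pos_divide_le_eq) simp_all
  qed
  finally show "exp (- t) - 1 + t \<le> t\<^sup>2" by simp
qed

lemma lk_kernel_measurable [measurable]: "lk_kernel y \<in> borel_measurable borel"
  unfolding lk_kernel_def by measurable

lemma lk_kernel_small:
  assumes "0 < u" "u \<le> 1" "0 \<le> y"
  shows "0 \<le> lk_kernel y u" "lk_kernel y u \<le> y\<^sup>2 * min 1 (u\<^sup>2)"
proof -
  have K: "lk_kernel y u = exp (- (u * y)) - 1 + u * y"
    using assms by (simp add: lk_kernel_def)
  have "u\<^sup>2 \<le> 1" using assms by (simp add: power_le_one)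
  then have w: "min 1 (u\<^sup>2) = u\<^sup>2" by (rule min_absorb2)
  have t: "0 \<le> u * y" using assms by simp
  show "0 \<le> lk_kernel y u" unfolding K by (rule exp_minus_taylor_bounds(1)[OF t])
  have "lk_kernel y u \<le> (u * y)\<^sup>2" unfolding K by (rule exp_minus_taylor_bounds(2)[OF t])
  then show "lk_kernel y u \<le> y\<^sup>2 * min 1 (u\<^sup>2)"
    unfolding w by (simp only: power_mult_distrib mult.commute)
qed

lemma lk_kernel_large: "1 < u \<Longrightarrow> lk_kernel y u = exp (- (u * y)) - 1"
  by (simp add: lk_kernel_def)

lemma min_square_large: "1 < u \<Longrightarrow> min 1 (u\<^sup>2) = (1::real)"
  by (simp add: min_def)

lemma min_square_nonneg: "0 \<le> min 1 (u\<^sup>2 :: real)"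
  by simp

text \<open>The bound is uniform for bounded \<open>y\<close>, as dominated convergence requires.\<close>

lemma lk_kernel_bound:
  assumes "0 < u" "0 \<le> y" "y \<le> M"
  shows "\<bar>lk_kernel y u\<bar> \<le> (1 + M\<^sup>2) * min 1 (u\<^sup>2)"
proof (cases "u \<le> 1")
  case True
  have "y\<^sup>2 \<le> 1 + M\<^sup>2" using power_mono[OF assms(3,2), of 2] by linarith
  then have "y\<^sup>2 * min 1 (u\<^sup>2) \<le> (1 + M\<^sup>2) * min 1 (u\<^sup>2)"
    by (intro mult_right_mono min_square_nonneg)
  with lk_kernel_small[OF assms(1) True assms(2)] show ?thesis by linarith
next
  case False
  then have "exp (- (u * y)) \<le> 1" "0 < exp (- (u * y))" using assms by auto
  then have "\<bar>lk_kernel y u\<bar> \<le> 1" using False lk_kernel_large[of u y] by linarith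
  moreover have "min 1 (u\<^sup>2) = 1" using False by (intro min_square_large) simp
  ultimately show ?thesis by (simp add: add_increasing2)
qed

lemma integrable_lk_kernel:
  assumes "levy_measure \<nu>" "0 \<le> y"
  shows "integrable \<nu> (lk_kernel y)"
proof (rule integrable_pos_bound)
  show "sets \<nu> = sets pos_borel" "integrable \<nu> (\<lambda>u. min 1 (u\<^sup>2))"
    using assms(1) by (simp_all add: levy_measure_def)
  show "\<bar>lk_kernel y u\<bar> \<le> (1 + y\<^sup>2) * min 1 (u\<^sup>2)" if "0 < u" for u
    using that assms(2) by (intro lk_kernel_bound) simp_all
qed measurable

lemma continuous_on_lk_exponent:
  assumes "levy_measure \<nu>"
  shows "continuous_on {0..} (lk_exponent \<nu> a b c)"
proof -
  have sets: "sets \<nu> = sets pos_borel" and int: "integrable \<nu> (\<lambda>u. min 1 (u\<^sup>2))"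
    using assms by (auto simp: levy_measure_def)
  have "continuous_on {0..} (\<lambda>y. \<integral>u. lk_kernel y u \<partial>\<nu>)"
  proof (rule continuous_on_sequentiallyI)
    fix s :: "nat \<Rightarrow> real" and y
    assume s: "\<forall>n. s n \<in> {0..}" and lim: "s \<longlonglongrightarrow> y"
    obtain M where M: "\<And>n. \<bar>s n\<bar> \<le> M"
      using convergent_imp_Bseq[of s] lim by (auto simp: convergent_def Bseq_def)
    show "(\<lambda>n. \<integral>u. lk_kernel (s n) u \<partial>\<nu>) \<longlonglongrightarrow> (\<integral>u. lk_kernel y u \<partial>\<nu>)"
    proof (rule integral_dominated_convergence)
      show "integrable \<nu> (\<lambda>u. (1 + M\<^sup>2) * min 1 (u\<^sup>2))" using int by simp
      show "lk_kernel y \<in> borel_measurable \<nu>" "\<And>n. lk_kernel (s n) \<in> borel_measurable \<nu>"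
        by (simp_all add: borel_measurable_pos[OF sets])
      show "AE u in \<nu>. (\<lambda>n. lk_kernel (s n) u) \<longlonglongrightarrow> lk_kernel y u"
        unfolding lk_kernel_def by (intro AE_I2 tendsto_intros lim)
      show "AE u in \<nu>. norm (lk_kernel (s n) u) \<le> (1 + M\<^sup>2) * min 1 (u\<^sup>2)" for n
      proof (rule AE_I2)
        fix u assume "u \<in> space \<nu>"
        then have "0 < u" using space_pos_borel[OF sets] by simp
        moreover have "0 \<le> s n" "s n \<le> M" using s M[of n] by auto
        ultimately show "norm (lk_kernel (s n) u) \<le> (1 + M\<^sup>2) * min 1 (u\<^sup>2)"
          using lk_kernel_bound by simp
      qed
    qed
  qed
  then show ?thesis unfolding lk_exponent_def by (intro continuous_intros)
qed

lemma lk_kernel_convex: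
  assumes "0 \<le> t" "t \<le> 1"
  shows "lk_kernel ((1 - t) * x + t * y) u \<le> (1 - t) * lk_kernel x u + t * lk_kernel y u"
proof -
  have "exp ((1 - t) * (- (u * x)) + t * (- (u * y)))
      \<le> (1 - t) * exp (- (u * x)) + t * exp (- (u * y))"
    using convex_onD[OF exp_convex assms, of "- (u * x)" "- (u * y)"] by simp
  moreover have "(1 - t) * (- (u * x)) + t * (- (u * y)) = - (u * ((1 - t) * x + t * y))"
    by (simp add: algebra_simps)
  ultimately show ?thesis by (simp add: lk_kernel_def algebra_simps)
qed

lemma convex_on_lk_exponent:
  assumes "levy_measure \<nu>" "0 \<le> a"
  shows "convex_on {0..} (lk_exponent \<nu> a b c)"
proof (rule convex_onI)
  fix t x y :: real
  assume t: "0 < t" "t < 1" and xy: "x \<in> {0..}" "y \<in> {0..}"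
  let ?z = "(1 - t) * x + t * y"
  have z: "0 \<le> ?z" using t xy by simp
  note int = integrable_lk_kernel[OF assms(1)]
  have "(\<integral>u. lk_kernel ?z u \<partial>\<nu>) \<le> (\<integral>u. (1 - t) * lk_kernel x u + t * lk_kernel y u \<partial>\<nu>)"
    using t xy z int lk_kernel_convex by (intro integral_mono) auto
  also have "\<dots> = (1 - t) * (\<integral>u. lk_kernel x u \<partial>\<nu>) + t * (\<integral>u. lk_kernel y u \<partial>\<nu>)"
    using xy int by simp
  finally have K: "(\<integral>u. lk_kernel ?z u \<partial>\<nu>)
      \<le> (1 - t) * (\<integral>u. lk_kernel x u \<partial>\<nu>) + t * (\<integral>u. lk_kernel y u \<partial>\<nu>)" .
  have "(1 - t) * x\<^sup>2 + t * y\<^sup>2 - ?z\<^sup>2 = t * (1 - t) * (x - y)\<^sup>2" by algebra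
  moreover have "0 \<le> t * (1 - t) * (x - y)\<^sup>2" using t by simp
  ultimately have "?z\<^sup>2 \<le> (1 - t) * x\<^sup>2 + t * y\<^sup>2" by linarith
  then have Q: "a * ?z\<^sup>2 \<le> a * ((1 - t) * x\<^sup>2 + t * y\<^sup>2)" using assms(2) by (rule mult_left_mono)
  show "lk_exponent \<nu> a b c ((1 - t) *\<^sub>R x + t *\<^sub>R y)
      \<le> (1 - t) * lk_exponent \<nu> a b c x + t * lk_exponent \<nu> a b c y"
    using K Q unfolding lk_exponent_def by (simp add: algebra_simps)
qed simp

text \<open>Fatou's lemma, in the form that yields integrability of the limit.\<close>

lemma fatou_integrable:
  fixes f :: "nat \<Rightarrow> 'a \<Rightarrow> real" and g :: "'a \<Rightarrow> real"
  assumes f: "\<And>n. integrable M (f n)" "\<And>n u. u \<in> space M \<Longrightarrow> 0 \<le> f n u"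
    and lim: "\<And>u. u \<in> space M \<Longrightarrow> (\<lambda>n. f n u) \<longlonglongrightarrow> g u"
    and bound: "\<And>n. (\<integral>u. f n u \<partial>M) \<le> B n" "B \<longlonglongrightarrow> L"
  shows "integrable M g" "(\<integral>u. g u \<partial>M) \<le> L"
proof -
  have meas: "\<And>n. f n \<in> borel_measurable M" using f(1) by auto
  have g: "g \<in> borel_measurable M" by (rule borel_measurable_LIMSEQ_real[OF lim meas])
  have g0: "0 \<le> g u" if "u \<in> space M" for u
    using lim[OF that] f(2)[OF that] by (intro LIMSEQ_le_const) auto
  have I0: "0 \<le> (\<integral>u. f n u \<partial>M)" for n using f(2) by simp
  have L0: "0 \<le> L" using bound I0 by (intro LIMSEQ_le_const[OF bound(2)]) (meson order_trans)
  have "(\<integral>\<^sup>+u. ennreal (g u) \<partial>M) = (\<integral>\<^sup>+u. liminf (\<lambda>n. ennreal (f n u)) \<partial>M)"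
    by (intro nn_integral_cong lim_imp_Liminf[symmetric] tendsto_ennrealI lim) auto
  also have "\<dots> \<le> liminf (\<lambda>n. \<integral>\<^sup>+u. ennreal (f n u) \<partial>M)"
    using meas by (intro nn_integral_liminf) auto
  also have "\<dots> \<le> liminf (\<lambda>n. ennreal (B n))"
  proof (rule Liminf_mono, rule always_eventually, rule allI)
    fix n
    have "(\<integral>\<^sup>+u. ennreal (f n u) \<partial>M) = ennreal (\<integral>u. f n u \<partial>M)"
      using f by (intro nn_integral_eq_integral) auto
    then show "(\<integral>\<^sup>+u. ennreal (f n u) \<partial>M) \<le> ennreal (B n)"
      using bound(1)[of n] by (simp add: ennreal_leI)
  qed
  also have "\<dots> = ennreal L" by (intro lim_imp_Liminf tendsto_ennrealI bound) auto
  finally have le: "(\<integral>\<^sup>+u. ennreal (g u) \<partial>M) \<le> ennreal L" .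
  show gi: "integrable M g"
    using g g0 le by (intro integrableI_nonneg) (auto intro: le_less_trans)
  have "ennreal (\<integral>u. g u \<partial>M) = (\<integral>\<^sup>+u. ennreal (g u) \<partial>M)"
    using gi g0 by (intro nn_integral_eq_integral[symmetric]) auto
  with le show "(\<integral>u. g u \<partial>M) \<le> L" using L0 by (metis ennreal_le_iff)
qed

section \<open>Sign and shape of the exponents\<close>

lemma lk_exponent_eq_0 [simp]: "lk_exponent \<nu> a b c 0 = - c"
  by (simp add: lk_exponent_def lk_kernel_def)

lemma pk_spLp_cong: "\<Psi> \<in> pk_spLp \<Longrightarrow> (\<And>y. 0 \<le> y \<Longrightarrow> \<Psi>' y = \<Psi> y) \<Longrightarrow> \<Psi>' \<in> pk_spLp"
  unfolding pk_spLp_iff by fastforce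

lemma spLp_nonup_cong:
  "\<Sigma> \<in> spLp_nonup \<Longrightarrow> \<forall>y\<ge>0. \<Sigma>' y = \<Sigma> y \<Longrightarrow> \<Sigma>' \<in> spLp_nonup"
  by (simp add: spLp_nonup_def)

lemma pk_subo_cong: "\<Phi> \<in> pk_subo \<Longrightarrow> \<forall>y\<ge>0. \<Phi>' y = \<Phi> y \<Longrightarrow> \<Phi>' \<in> pk_subo"
  by (simp add: pk_subo_def)

lemma pk_spLp_at_zero: "\<Psi> \<in> pk_spLp \<Longrightarrow> \<Psi> 0 \<le> 0"
  unfolding pk_spLp_iff by auto

lemma pk_spLp_continuous:
  assumes "\<Psi> \<in> pk_spLp"
  shows "continuous_on {0..} \<Psi>"
proof -
  obtain \<nu> a b c where "levy_measure \<nu>" and eq: "\<forall>y\<ge>0. \<Psi> y = lk_exponent \<nu> a b c y"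
    using assms unfolding pk_spLp_iff by blast
  from this(1) have "continuous_on {0..} (lk_exponent \<nu> a b c)"
    by (rule continuous_on_lk_exponent)
  moreover have "continuous_on {0..} \<Psi> \<longleftrightarrow> continuous_on {0..} (lk_exponent \<nu> a b c)"
    using eq by (intro continuous_on_cong) auto
  ultimately show ?thesis by blast
qed

lemma pk_spLp_convex:
  assumes "\<Psi> \<in> pk_spLp"
  shows "convex_on {0..} \<Psi>"
proof -
  obtain \<nu> a b c where "levy_measure \<nu>" "0 \<le> a" and eq: "\<forall>y\<ge>0. \<Psi> y = lk_exponent \<nu> a b c y"
    using assms unfolding pk_spLp_iff by blast
  then have "convex_on {0..} (lk_exponent \<nu> a b c)"
    using convex_on_lk_exponent by blast
  then show ?thesis using eq by (simp add: convex_on_def)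
qed

text \<open>A member of the class whose negative is a member as well is convex and concave.\<close>

lemma pk_spLp_both_signs_affine:
  assumes G: "G \<in> pk_spLp" and nG: "(\<lambda>y. - G y) \<in> pk_spLp" and x: "0 \<le> x"
  shows "G x = G 0 + x * (G 1 - G 0)"
proof -
  have mid: "G ((1 - t) * p + t * q) = (1 - t) * G p + t * G q"
    if "0 \<le> t" "t \<le> 1" "0 \<le> p" "0 \<le> q" for t p q
    using convex_onD[OF pk_spLp_convex[OF G], of t p q]
      convex_onD[OF pk_spLp_convex[OF nG], of t p q] that by simp
  show ?thesis
  proof (cases "x \<le> 1")
    case True
    then show ?thesis using mid[of x 0 1] x by (simp add: algebra_simps)
  next
    case False
    \<comment> \<open>Here \<open>1\<close> is a convex combination of \<open>0\<close> and \<open>x\<close>.\<close>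
    then have "G 1 = (1 - 1 / x) * G 0 + (1 / x) * G x" using mid[of "1 / x" 0 x] by simp
    then show ?thesis using False by (simp add: field_simps)
  qed
qed

text \<open>A nonnegative exponent has no killing; dividing it by \<open>y\<close> and letting \<open>y \<rightarrow> 0\<close> shows by
  Fatou's lemma that the large jumps have a mean which is at most \<open>- b\<close>.\<close>

lemma pk_spLp_nonneg_imp_spLp_nonup:
  assumes "\<Psi> \<in> pk_spLp" and nonneg: "\<And>y. 0 \<le> y \<Longrightarrow> 0 \<le> \<Psi> y"
  shows "\<Psi> \<in> spLp_nonup"
proof -
  obtain \<nu> a b c where \<nu>: "levy_measure \<nu>" and a: "0 \<le> a" and c: "0 \<le> c"
    and eq: "\<forall>y\<ge>0. \<Psi> y = lk_exponent \<nu> a b c y"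
    using assms(1) unfolding pk_spLp_iff by blast
  have sets: "sets \<nu> = sets pos_borel" and w: "integrable \<nu> (\<lambda>u. min 1 (u\<^sup>2))"
    using \<nu> by (auto simp: levy_measure_def)
  note pos = space_pos_borel[OF sets]
  have c0: "c = 0" using nonneg[of 0] eq c by simp
  define W where "W = (\<integral>u. min 1 (u\<^sup>2) \<partial>\<nu>)"
  define y :: "nat \<Rightarrow> real" where "y n = 1 / real (Suc n)" for n
  have y0: "0 < y n" for n by (simp add: y_def)
  have ylim: "y \<longlonglongrightarrow> 0"
    unfolding y_def using LIMSEQ_inverse_real_of_nat by (simp add: inverse_eq_divide)
  \<comment> \<open>\<open>f n\<close> is the contribution of the large jumps to \<open>- \<Psi> (y n) / y n\<close>.\<close>
  define f where "f n u = (1 - exp (- (u * y n))) / y n * indicator {1<..} u" for n u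
  define g where "g u = u * indicator {1<..} u" for u :: real
  have f_int: "integrable \<nu> (f n)" for n
  proof (rule integrable_pos_bound[OF sets w])
    show "f n \<in> borel_measurable borel" unfolding f_def by measurable
    fix u :: real assume u: "0 < u"
    show "\<bar>f n u\<bar> \<le> (1 / y n) * min 1 (u\<^sup>2)"
    proof (cases "u \<le> 1")
      case True then show ?thesis using y0[of n] by (simp add: f_def)
    next
      case False
      then have "\<bar>1 - exp (- (u * y n))\<bar> \<le> 1" using y0[of n] by simp
      then show ?thesis
        using False y0[of n] min_square_large[of u] by (simp add: f_def abs_mult divide_right_mono)
    qed
  qed
  have f_nonneg: "0 \<le> f n u" if "u \<in> space \<nu>" for n u
    using that pos y0[of n] by (simp add: f_def indicator_def)
  have f_lim: "(\<lambda>n. f n u) \<longlonglongrightarrow> g u" if "u \<in> space \<nu>" for u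
  proof -
    have u: "0 < u" using that pos by simp
    have "((\<lambda>t::real. (1 - exp (- (u * t))) / t) \<longlongrightarrow> u) (at_right 0)"
      using u by real_asymp
    moreover have "filterlim y (at_right 0) sequentially"
      using ylim y0 by (intro tendsto_imp_filterlim_at_right) auto
    ultimately have "(\<lambda>n. (1 - exp (- (u * y n))) / y n) \<longlonglongrightarrow> u"
      by (rule filterlim_compose)
    then show ?thesis unfolding f_def g_def by (intro tendsto_mult tendsto_const)
  qed
  have f_bound: "(\<integral>u. f n u \<partial>\<nu>) \<le> y n * W + a * y n - b" for n
  proof -
    have K: "integrable \<nu> (lk_kernel (y n))" using y0[of n] by (intro integrable_lk_kernel[OF \<nu>]) simp
    have "f n u \<le> y n * min 1 (u\<^sup>2) - lk_kernel (y n) u / y n" if "u \<in> space \<nu>" for u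
    proof (cases "u \<le> 1")
      case True
      have "lk_kernel (y n) u \<le> (y n)\<^sup>2 * min 1 (u\<^sup>2)"
        using that pos True y0[of n] by (intro lk_kernel_small) auto
      then have "lk_kernel (y n) u / y n \<le> y n * min 1 (u\<^sup>2)"
        using y0[of n] by (simp add: pos_divide_le_eq power2_eq_square mult_ac)
      then show ?thesis using True by (simp add: f_def)
    next
      case False
      then have u: "1 < u" by simp
      have "f n u = - (lk_kernel (y n) u / y n)"
        using u by (simp add: f_def lk_kernel_large minus_divide_left)
      then show ?thesis using y0[of n] min_square_large[OF u] by simp
    qed
    then have "(\<integral>u. f n u \<partial>\<nu>) \<le> (\<integral>u. y n * min 1 (u\<^sup>2) - lk_kernel (y n) u / y n \<partial>\<nu>)"
      using w K f_int by (intro integral_mono) auto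
    also have "\<dots> = y n * W - (\<integral>u. lk_kernel (y n) u \<partial>\<nu>) / y n"
      using w K by (simp add: W_def)
    also have "\<dots> \<le> y n * W + a * y n - b"
    proof -
      have "0 \<le> (\<integral>u. lk_kernel (y n) u \<partial>\<nu>) + a * (y n)\<^sup>2 - b * y n"
        using nonneg[of "y n"] eq y0[of n] c0 by (simp add: lk_exponent_def less_imp_le)
      then have "(b - a * y n) * y n \<le> (\<integral>u. lk_kernel (y n) u \<partial>\<nu>)"
        by (simp add: power2_eq_square algebra_simps)
      then have "b - a * y n \<le> (\<integral>u. lk_kernel (y n) u \<partial>\<nu>) / y n"
        using y0[of n] by (simp add: pos_le_divide_eq)
      then show ?thesis by linarith
    qed
    finally show ?thesis .
  qed
  have B_lim: "(\<lambda>n. y n * W + a * y n - b) \<longlonglongrightarrow> - b"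
    using ylim by (auto intro!: tendsto_eq_intros)
  have g_int: "integrable \<nu> g" by (rule fatou_integrable(1)[OF f_int f_nonneg f_lim f_bound B_lim])
  have g_le: "(\<integral>u. g u \<partial>\<nu>) \<le> - b"
    by (rule fatou_integrable(2)[OF f_int f_nonneg f_lim f_bound B_lim])
  define d where "d = - b - (\<integral>u. g u \<partial>\<nu>)"
  have "integrable \<nu> (\<lambda>u. min u (u\<^sup>2))"
  proof (rule integrable_pos_bound[OF sets, where C = 1])
    show "integrable \<nu> (\<lambda>u. min 1 (u\<^sup>2) + g u)" using w g_int by simp
    show "\<bar>min u (u\<^sup>2)\<bar> \<le> 1 * (min 1 (u\<^sup>2) + g u)" if "0 < u" for u
    proof (cases "u \<le> 1")
      case True
      then have "u\<^sup>2 \<le> 1" using that by (simp add: power_le_one)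
      then show ?thesis using that True by (simp add: g_def)
    next
      case False
      then show ?thesis by (simp add: g_def min_def)
    qed
  qed measurable
  moreover have "\<Psi> y = (\<integral>u. (exp (- (u * y)) - 1 + u * y) \<partial>\<nu>) + a * y\<^sup>2 + d * y" if "0 \<le> y" for y
  proof -
    have "(\<integral>u. (exp (- (u * y)) - 1 + u * y) \<partial>\<nu>) = (\<integral>u. lk_kernel y u + y * g u \<partial>\<nu>)"
      using pos by (intro Bochner_Integration.integral_cong)
        (auto simp: lk_kernel_def g_def indicator_def)
    also have "\<dots> = (\<integral>u. lk_kernel y u \<partial>\<nu>) + y * (\<integral>u. g u \<partial>\<nu>)"
      using integrable_lk_kernel[OF \<nu> that] g_int by simp
    finally show ?thesis
      using eq[rule_format, OF that] c0 by (simp add: lk_exponent_def d_def algebra_simps)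
  qed
  moreover have "0 \<le> d" using g_le by (simp add: d_def)
  ultimately show ?thesis unfolding spLp_nonup_def using sets a by blast
qed

text \<open>Dividing a nonpositive exponent by \<open>y\<^sup>2\<close> and letting \<open>y \<rightarrow> \<infinity>\<close> removes the quadratic term;
  dividing it by \<open>y\<close> shows by Fatou's lemma that the small jumps have a mean, at most \<open>b\<close>.\<close>

lemma pk_spLp_nonpos_imp_pk_subo:
  assumes "\<Psi> \<in> pk_spLp" and nonpos: "\<And>y. 0 \<le> y \<Longrightarrow> \<Psi> y \<le> 0"
  shows "(\<lambda>y. - \<Psi> y) \<in> pk_subo"
proof -
  obtain \<nu> a b c where \<nu>: "levy_measure \<nu>" and a: "0 \<le> a" and c: "0 \<le> c"
    and eq: "\<forall>y\<ge>0. \<Psi> y = lk_exponent \<nu> a b c y"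
    using assms(1) unfolding pk_spLp_iff by blast
  have sets: "sets \<nu> = sets pos_borel" and w: "integrable \<nu> (\<lambda>u. min 1 (u\<^sup>2))"
    using \<nu> by (auto simp: levy_measure_def)
  note pos = space_pos_borel[OF sets]
  define W where "W = (\<integral>u. min 1 (u\<^sup>2) \<partial>\<nu>)"
  define y :: "nat \<Rightarrow> real" where "y n = real (Suc n)" for n
  have y0: "0 < y n" for n by (simp add: y_def)
  have ytop: "filterlim y at_top sequentially"
    unfolding y_def using filterlim_compose[OF filterlim_real_sequentially filterlim_Suc] .
  have K: "integrable \<nu> (lk_kernel (y n))" for n
    using y0[of n] by (intro integrable_lk_kernel[OF \<nu>]) simp
  have bal: "(\<integral>u. lk_kernel (y n) u \<partial>\<nu>) + a * (y n)\<^sup>2 \<le> b * y n + c" for n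
    using nonpos[of "y n"] eq y0[of n] by (simp add: lk_exponent_def less_imp_le)
  have a0: "a = 0"
  proof -
    have "a \<le> b / y n + (c + W) / (y n)\<^sup>2" for n
    proof -
      have "- W = (\<integral>u. - min 1 (u\<^sup>2) \<partial>\<nu>)" by (simp add: W_def)
      also have "\<dots> \<le> (\<integral>u. lk_kernel (y n) u \<partial>\<nu>)"
      proof (intro integral_mono K)
        fix u assume "u \<in> space \<nu>"
        then have u: "0 < u" using pos by simp
        show "- min 1 (u\<^sup>2) \<le> lk_kernel (y n) u"
        proof (cases "u \<le> 1")
          case True
          then show ?thesis
            using lk_kernel_small(1)[OF u True, of "y n"] y0[of n] min_square_nonneg[of u] by linarith
        next
          case False
          then show ?thesis
            using min_square_large[of u] exp_gt_zero[of "- (u * y n)"]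
            by (simp only: not_le lk_kernel_large)
        qed
      qed (use w in simp)
      finally have "a * (y n)\<^sup>2 \<le> b * y n + (c + W)" using bal[of n] by linarith
      then have "a \<le> (b * y n + (c + W)) / (y n)\<^sup>2"
        using y0[of n] by (simp add: pos_le_divide_eq)
      also have "\<dots> = b / y n + (c + W) / (y n)\<^sup>2"
        using y0[of n] by (simp add: add_divide_distrib power2_eq_square)
      finally show ?thesis .
    qed
    moreover have "(\<lambda>n. b / y n + (c + W) / (y n)\<^sup>2) \<longlonglongrightarrow> 0"
      by (rule filterlim_compose[OF _ ytop, of "\<lambda>t. b / t + (c + W) / t\<^sup>2"]) real_asymp
    ultimately have "a \<le> 0" by (intro LIMSEQ_le_const) auto
    then show ?thesis using a by simp
  qed
  \<comment> \<open>\<open>f n\<close> is the contribution of the small jumps to \<open>\<Psi> (y n) / y n\<close>.\<close>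
  define f where "f n u = (exp (- (u * y n)) - 1 + u * y n) / y n * indicator {..1} u" for n u
  define g where "g u = u * indicator {..1} u" for u :: real
  have f_small: "f n u = lk_kernel (y n) u / y n" if "u \<in> space \<nu>" "u \<le> 1" for n u
    using that pos by (simp add: f_def lk_kernel_def)
  have f_int: "integrable \<nu> (f n)" for n
  proof (rule integrable_pos_bound[OF sets w, where C = "y n"])
    show "f n \<in> borel_measurable borel" unfolding f_def by measurable
    fix u :: real assume u: "0 < u"
    show "\<bar>f n u\<bar> \<le> y n * min 1 (u\<^sup>2)"
    proof (cases "u \<le> 1")
      case True
      have "0 \<le> lk_kernel (y n) u" "lk_kernel (y n) u \<le> (y n)\<^sup>2 * min 1 (u\<^sup>2)"
        using True u y0[of n] by (auto intro!: lk_kernel_small)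
      then show ?thesis using f_small[of u n] u pos True y0[of n]
        by (simp add: pos_divide_le_eq power2_eq_square mult_ac)
    next
      case False then show ?thesis using y0[of n] by (simp add: f_def)
    qed
  qed
  have f_nonneg: "0 \<le> f n u" if "u \<in> space \<nu>" for n u
    using that pos y0[of n] exp_minus_taylor_bounds(1)[of "u * y n"] by (simp add: f_def)
  have f_lim: "(\<lambda>n. f n u) \<longlonglongrightarrow> g u" if "u \<in> space \<nu>" for u
  proof -
    have u: "0 < u" using that pos by simp
    have "((\<lambda>t::real. (exp (- (u * t)) - 1 + u * t) / t) \<longlongrightarrow> u) at_top"
      using u by real_asymp
    then have "(\<lambda>n. (exp (- (u * y n)) - 1 + u * y n) / y n) \<longlonglongrightarrow> u"
      by (rule filterlim_compose[OF _ ytop])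
    then show ?thesis unfolding f_def g_def by (intro tendsto_mult tendsto_const)
  qed
  have f_bound: "(\<integral>u. f n u \<partial>\<nu>) \<le> b + (c + W) / y n" for n
  proof -
    have "f n u \<le> (lk_kernel (y n) u + min 1 (u\<^sup>2)) / y n" if "u \<in> space \<nu>" for u
    proof (cases "u \<le> 1")
      case True
      then show ?thesis using f_small[OF that True] y0[of n] by (simp add: divide_right_mono)
    next
      case False
      then have "0 \<le> lk_kernel (y n) u + min 1 (u\<^sup>2)"
        using min_square_large[of u] lk_kernel_large[of u "y n"] by simp
      then show ?thesis using False y0[of n] by (simp add: f_def)
    qed
    then have "(\<integral>u. f n u \<partial>\<nu>) \<le> (\<integral>u. (lk_kernel (y n) u + min 1 (u\<^sup>2)) / y n \<partial>\<nu>)"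
      using w K f_int by (intro integral_mono) auto
    also have "\<dots> = ((\<integral>u. lk_kernel (y n) u \<partial>\<nu>) + W) / y n"
      using w K by (simp add: W_def)
    also have "\<dots> \<le> (b * y n + c + W) / y n"
      using bal[of n] a0 y0[of n] by (intro divide_right_mono) auto
    also have "\<dots> = b + (c + W) / y n" using y0[of n] by (simp add: add_divide_distrib)
    finally show ?thesis .
  qed
  have B_lim: "(\<lambda>n. b + (c + W) / y n) \<longlonglongrightarrow> b"
    by (rule filterlim_compose[OF _ ytop, of "\<lambda>t. b + (c + W) / t"]) real_asymp
  have g_int: "integrable \<nu> g" by (rule fatou_integrable(1)[OF f_int f_nonneg f_lim f_bound B_lim])
  have g_le: "(\<integral>u. g u \<partial>\<nu>) \<le> b"
    by (rule fatou_integrable(2)[OF f_int f_nonneg f_lim f_bound B_lim])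
  define d where "d = b - (\<integral>u. g u \<partial>\<nu>)"
  have "integrable \<nu> (\<lambda>u. min 1 u)"
  proof (rule integrable_pos_bound[OF sets, where C = 1])
    show "integrable \<nu> (\<lambda>u. min 1 (u\<^sup>2) + g u)" using w g_int by simp
    show "\<bar>min 1 u\<bar> \<le> 1 * (min 1 (u\<^sup>2) + g u)" if "0 < u" for u
    proof (cases "u \<le> 1")
      case True
      then show ?thesis using that by (simp add: g_def)
    next
      case False
      then show ?thesis using min_square_large[of u] by (simp add: g_def)
    qed
  qed measurable
  moreover have "- \<Psi> y = (\<integral>u. (1 - exp (- (u * y))) \<partial>\<nu>) + d * y + c" if "0 \<le> y" for y
  proof -
    have "(\<integral>u. (1 - exp (- (u * y))) \<partial>\<nu>) = (\<integral>u. y * g u - lk_kernel y u \<partial>\<nu>)"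
      using pos by (intro Bochner_Integration.integral_cong)
        (auto simp: lk_kernel_def g_def indicator_def)
    also have "\<dots> = y * (\<integral>u. g u \<partial>\<nu>) - (\<integral>u. lk_kernel y u \<partial>\<nu>)"
      using integrable_lk_kernel[OF \<nu> that] g_int by simp
    finally show ?thesis
      using eq[rule_format, OF that] a0 by (simp add: lk_exponent_def d_def algebra_simps)
  qed
  moreover have "0 \<le> d" using g_le by (simp add: d_def)
  ultimately show ?thesis unfolding pk_subo_def using sets c by blast
qed

lemma spLp_nonup_at_zero: "\<Sigma> \<in> spLp_nonup \<Longrightarrow> \<Sigma> 0 = 0"
  by (auto simp: spLp_nonup_def)

lemma pk_subo_nonneg:
  assumes "\<Phi> \<in> pk_subo" "0 \<le> y"
  shows "0 \<le> \<Phi> y"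
proof -
  obtain \<nu> d c where \<nu>: "sets \<nu> = sets pos_borel" and dc: "0 \<le> d" "0 \<le> c"
    and eq: "\<forall>y\<ge>0. \<Phi> y = (\<integral>u. (1 - exp (- (u * y))) \<partial>\<nu>) + d * y + c"
    using assms(1) unfolding pk_subo_def by blast
  have "0 \<le> (\<integral>u. (1 - exp (- (u * y))) \<partial>\<nu>)"
    using assms(2) space_pos_borel[OF \<nu>] by (intro integral_nonneg_AE AE_I2) simp
  then show ?thesis using eq assms(2) dc by simp
qed

text \<open>The compensation of large jumps is absorbed by the drift.\<close>

lemma spLp_nonup_subset_pk_spLp:
  assumes "\<Sigma> \<in> spLp_nonup"
  shows "\<Sigma> \<in> pk_spLp"
proof -
  obtain \<nu> a d where sets: "sets \<nu> = sets pos_borel" and int: "integrable \<nu> (\<lambda>u. min u (u\<^sup>2))"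
    and ad: "0 \<le> a" "0 \<le> d"
    and eq: "\<forall>y\<ge>0. \<Sigma> y = (\<integral>u. (exp (- (u * y)) - 1 + u * y) \<partial>\<nu>) + a * y\<^sup>2 + d * y"
    using assms(1) unfolding spLp_nonup_def by blast
  note pos = space_pos_borel[OF sets]
  have "integrable \<nu> (\<lambda>u. min 1 (u\<^sup>2))"
  proof (rule integrable_pos_bound[OF sets int, where C = 1])
    show "\<bar>min 1 (u\<^sup>2)\<bar> \<le> 1 * min u (u\<^sup>2)" if "0 < u" for u :: real
    proof (cases "u \<le> 1")
      case True
      then have "u\<^sup>2 \<le> u" using that by (simp add: power2_eq_square)
      then show ?thesis by simp
    next
      case False
      then have "u \<le> u\<^sup>2" by (simp add: power2_eq_square)
      then show ?thesis using False by simp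
    qed
  qed measurable
  then have \<nu>: "levy_measure \<nu>" using sets by (simp add: levy_measure_def)
  define g where "g u = u * indicator {1<..} u" for u :: real
  have g_int: "integrable \<nu> g"
  proof (rule integrable_pos_bound[OF sets int, where C = 1])
    show "\<bar>g u\<bar> \<le> 1 * min u (u\<^sup>2)" if "0 < u" for u :: real
      using that by (auto simp: g_def indicator_def power2_eq_square)
  qed (unfold g_def, measurable)
  have "\<Sigma> y = lk_exponent \<nu> a (- (d + (\<integral>u. g u \<partial>\<nu>))) 0 y" if "0 \<le> y" for y
  proof -
    have "(\<integral>u. (exp (- (u * y)) - 1 + u * y) \<partial>\<nu>) = (\<integral>u. lk_kernel y u + y * g u \<partial>\<nu>)"
      using pos by (intro Bochner_Integration.integral_cong)
        (auto simp: lk_kernel_def g_def indicator_def)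
    also have "\<dots> = (\<integral>u. lk_kernel y u \<partial>\<nu>) + y * (\<integral>u. g u \<partial>\<nu>)"
      using integrable_lk_kernel[OF \<nu> that] g_int by simp
    finally show ?thesis using eq[rule_format, OF that] by (simp add: lk_exponent_def algebra_simps)
  qed
  then show ?thesis unfolding pk_spLp_iff using \<nu> ad by (metis order_refl)
qed

text \<open>The missing compensation of small jumps is absorbed by the drift.\<close>

lemma uminus_pk_subo_in_pk_spLp:
  assumes "\<Phi> \<in> pk_subo"
  shows "(\<lambda>y. - \<Phi> y) \<in> pk_spLp"
proof -
  obtain \<nu> d c where sets: "sets \<nu> = sets pos_borel" and int: "integrable \<nu> (\<lambda>u. min 1 u)"
    and dc: "0 \<le> d" "0 \<le> c"
    and eq: "\<forall>y\<ge>0. \<Phi> y = (\<integral>u. (1 - exp (- (u * y))) \<partial>\<nu>) + d * y + c"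
    using assms(1) unfolding pk_subo_def by blast
  note pos = space_pos_borel[OF sets]
  have "integrable \<nu> (\<lambda>u. min 1 (u\<^sup>2))"
  proof (rule integrable_pos_bound[OF sets int, where C = 1])
    show "\<bar>min 1 (u\<^sup>2)\<bar> \<le> 1 * min 1 u" if "0 < u" for u :: real
    proof (cases "u \<le> 1")
      case True
      then have "u\<^sup>2 \<le> u" using that by (simp add: power2_eq_square)
      then show ?thesis using True by simp
    qed simp
  qed measurable
  then have \<nu>: "levy_measure \<nu>" using sets by (simp add: levy_measure_def)
  define g where "g u = u * indicator {..1} u" for u :: real
  have g_int: "integrable \<nu> g"
  proof (rule integrable_pos_bound[OF sets int, where C = 1])
    show "\<bar>g u\<bar> \<le> 1 * min 1 u" if "0 < u" for u :: real
      using that by (auto simp: g_def indicator_def)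
  qed (unfold g_def, measurable)
  have "- \<Phi> y = lk_exponent \<nu> 0 (d + (\<integral>u. g u \<partial>\<nu>)) c y" if "0 \<le> y" for y
  proof -
    have "(\<integral>u. (1 - exp (- (u * y))) \<partial>\<nu>) = (\<integral>u. y * g u - lk_kernel y u \<partial>\<nu>)"
      using pos by (intro Bochner_Integration.integral_cong)
        (auto simp: lk_kernel_def g_def indicator_def)
    also have "\<dots> = y * (\<integral>u. g u \<partial>\<nu>) - (\<integral>u. lk_kernel y u \<partial>\<nu>)"
      using integrable_lk_kernel[OF \<nu> that] g_int by simp
    finally show ?thesis using eq[rule_format, OF that] by (simp add: lk_exponent_def algebra_simps)
  qed
  then show ?thesis unfolding pk_spLp_iff using \<nu> dc by (metis order_refl)
qed

section \<open>Exponential combinations and integro-differential operators\<close>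

lemma expo_comb_ennreal:
  "0 \<le> t \<Longrightarrow> expo_comb S k (ennreal t) = (\<Sum>y\<in>S. k y * exp (- (t * y)))"
  by (simp add: expo_comb_def expo_def)

lemma expo_in_span: "0 < y \<Longrightarrow> expo y \<in> expo_span"
  unfolding expo_span_def using expo_eq_comb[of y] by blast

lemma exp_sum_has_derivative:
  "((\<lambda>t. \<Sum>y\<in>S. k y * exp (- (t * y))) has_real_derivative
      (\<Sum>y\<in>S. - (y * k y) * exp (- (x * y)))) (at x within A)" for k :: "real \<Rightarrow> real"
  by (auto intro!: derivative_eq_intros sum.cong)

lemma deriv_expo_comb:
  assumes "0 < x"
  shows "deriv (\<lambda>t. expo_comb S k (ennreal t)) x = expo_comb S (\<lambda>y. - (y * k y)) (ennreal x)"
proof (rule DERIV_imp_deriv)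
  have "((\<lambda>t. expo_comb S k (ennreal t)) has_real_derivative
      (\<Sum>y\<in>S. - (y * k y) * exp (- (x * y)))) (at x)"
    by (rule has_field_derivative_transform_within_open[OF exp_sum_has_derivative, where S = "{0<..}"])
      (use assms in \<open>simp_all add: expo_comb_ennreal\<close>)
  then show "((\<lambda>t. expo_comb S k (ennreal t)) has_real_derivative
      expo_comb S (\<lambda>y. - (y * k y)) (ennreal x)) (at x)"
    using assms by (simp add: expo_comb_ennreal)
qed

lemma deriv_deriv_expo_comb:
  assumes "0 < x"
  shows "deriv (deriv (\<lambda>t. expo_comb S k (ennreal t))) x = expo_comb S (\<lambda>y. y\<^sup>2 * k y) (ennreal x)"
proof -
  have "\<forall>\<^sub>F t in nhds x. t \<in> {0<..}" by (rule eventually_nhds_in_open) (use assms in auto)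
  then have "\<forall>\<^sub>F t in nhds x. deriv (\<lambda>t. expo_comb S k (ennreal t)) t
      = expo_comb S (\<lambda>y. - (y * k y)) (ennreal t)"
    by (rule eventually_mono) (simp add: deriv_expo_comb)
  from deriv_cong_ev[OF this refl] show ?thesis
    using assms by (simp add: deriv_expo_comb power2_eq_square mult.assoc)
qed

lemma vector_derivative_expo_comb_0:
  "vector_derivative (\<lambda>t. expo_comb S k (ennreal t)) (at 0 within {0..}) = (\<Sum>y\<in>S. - (y * k y))"
proof (rule vector_derivative_within)
  show "at (0::real) within {0..} \<noteq> bot"
    using trivial_limit_at_right_real[of "0::real"] by (simp add: at_within_Ici_at_right)
  have "((\<lambda>t. \<Sum>y\<in>S. k y * exp (- (t * y))) has_vector_derivative
      (\<Sum>y\<in>S. - (y * k y) * exp (- (0 * y)))) (at 0 within {0..})"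
    using exp_sum_has_derivative unfolding has_real_derivative_iff_has_vector_derivative .
  then have "((\<lambda>t. \<Sum>y\<in>S. k y * exp (- (t * y))) has_vector_derivative
      (\<Sum>y\<in>S. - (y * k y))) (at 0 within {0..})" by simp
  then show "((\<lambda>t. expo_comb S k (ennreal t)) has_vector_derivative
      (\<Sum>y\<in>S. - (y * k y))) (at 0 within {0..})"
    by (rule has_vector_derivative_transform[rotated 2]) (simp_all add: expo_comb_ennreal)
qed

text \<open>On an exponential combination the integro-differential expression at an interior point
  multiplies each exponential by the exponent, and the boundary expression multiplies it by the
  negative of a member of \<open>pk_subo\<close>.\<close>

lemma interior_form_expo_comb:
  fixes k :: "real \<Rightarrow> real"
  assumes \<nu>: "levy_measure \<nu>" and S: "finite S" "S \<subseteq> {0<..}" and x: "0 < x"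
  defines "f \<equiv> expo_comb S k"
  shows "(\<integral>u. (f (ennreal (x + u)) - f (ennreal x)
          - u * deriv (\<lambda>t. f (ennreal t)) x * indicator {0<..1} u) \<partial>\<nu>)
        + a * deriv (deriv (\<lambda>t. f (ennreal t))) x + b * deriv (\<lambda>t. f (ennreal t)) x
        - c * f (ennreal x)
      = (\<Sum>y\<in>S. k y * exp (- (x * y)) * lk_exponent \<nu> a b c y)"
proof -
  have sets: "sets \<nu> = sets pos_borel" using \<nu> by (simp add: levy_measure_def)
  have int: "integrable \<nu> (lk_kernel y)" if "y \<in> S" for y
    using that S by (intro integrable_lk_kernel[OF \<nu>]) auto
  have "f (ennreal (x + u)) - f (ennreal x) - u * deriv (\<lambda>t. f (ennreal t)) x * indicator {0<..1} u
      = (\<Sum>y\<in>S. k y * exp (- (x * y)) * lk_kernel y u)" if "u \<in> space \<nu>" for u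
  proof -
    have "0 < u" using that space_pos_borel[OF sets] by simp
    then have "f (ennreal (x + u)) = (\<Sum>y\<in>S. k y * exp (- (x * y)) * exp (- (u * y)))"
      using x unfolding f_def expo_comb_ennreal[OF add_nonneg_nonneg[OF less_imp_le[OF x] less_imp_le[OF \<open>0 < u\<close>]]]
      by (simp add: ring_distribs exp_add[symmetric] mult.assoc)
    moreover have "u * deriv (\<lambda>t. f (ennreal t)) x * indicator {0<..1} u
        = (\<Sum>y\<in>S. - (k y * exp (- (x * y)) * (u * y * indicator {0<..1} u)))"
      using x unfolding f_def deriv_expo_comb[OF x] expo_comb_ennreal[OF less_imp_le[OF x]]
      by (simp add: sum_distrib_left sum_distrib_right mult_ac sum_negf)
    ultimately show ?thesis
      using x unfolding f_def lk_kernel_def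
      by (simp add: expo_comb_ennreal sum_negf sum.distrib sum_subtractf algebra_simps)
  qed
  then have "(\<integral>u. (f (ennreal (x + u)) - f (ennreal x)
          - u * deriv (\<lambda>t. f (ennreal t)) x * indicator {0<..1} u) \<partial>\<nu>)
      = (\<integral>u. (\<Sum>y\<in>S. k y * exp (- (x * y)) * lk_kernel y u) \<partial>\<nu>)"
    by (intro Bochner_Integration.integral_cong refl)
  also have "\<dots> = (\<Sum>y\<in>S. k y * exp (- (x * y)) * (\<integral>u. lk_kernel y u \<partial>\<nu>))"
    using int by (subst Bochner_Integration.integral_sum) auto
  finally have I: "(\<integral>u. (f (ennreal (x + u)) - f (ennreal x)
          - u * deriv (\<lambda>t. f (ennreal t)) x * indicator {0<..1} u) \<partial>\<nu>)
      = (\<Sum>y\<in>S. k y * exp (- (x * y)) * (\<integral>u. lk_kernel y u \<partial>\<nu>))" .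
  show ?thesis
    unfolding I unfolding f_def deriv_expo_comb[OF x] deriv_deriv_expo_comb[OF x]
      expo_comb_ennreal[OF less_imp_le[OF x]] lk_exponent_def
    by (simp add: sum_distrib_left sum_negf flip: sum.distrib sum_subtractf)
      (simp add: algebra_simps)
qed

lemma boundary_form_expo_comb:
  fixes k :: "real \<Rightarrow> real"
  assumes sets: "sets \<nu> = sets pos_borel" and int: "integrable \<nu> (\<lambda>u. min 1 u)"
    and S: "finite S" "S \<subseteq> {0<..}"
  defines "f \<equiv> expo_comb S k"
  shows "(\<integral>u. (f (ennreal u) - f 0) \<partial>\<nu>)
        + d * vector_derivative (\<lambda>t. f (ennreal t)) (at 0 within {0..}) - c * f 0
      = (\<Sum>y\<in>S. k y * - ((\<integral>u. (1 - exp (- (u * y))) \<partial>\<nu>) + d * y + c))"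
proof -
  have f0: "f 0 = (\<Sum>y\<in>S. k y)" using expo_comb_ennreal[of 0 S k] by (simp add: f_def)
  have int1: "integrable \<nu> (\<lambda>u. 1 - exp (- (u * y)))" if "y \<in> S" for y
  proof (rule integrable_pos_bound[OF sets int, where C = "1 + y"])
    have y: "0 < y" using that S by auto
    show "\<bar>1 - exp (- (u * y))\<bar> \<le> (1 + y) * min 1 u" if u: "0 < u" for u
    proof (cases "u \<le> 1")
      case True
      have "1 - exp (- (u * y)) \<le> u * y" using exp_ge_add_one_self[of "- (u * y)"] by simp
      moreover have "0 \<le> 1 - exp (- (u * y))" using u y by simp
      ultimately show ?thesis using True u by (simp add: min_def algebra_simps)
    next
      case False
      have "\<bar>1 - exp (- (u * y))\<bar> \<le> 1" using u y by simp
      also have "\<dots> \<le> (1 + y) * min 1 u" using False y by simp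
      finally show ?thesis .
    qed
  qed measurable
  have "(\<integral>u. (f (ennreal u) - f 0) \<partial>\<nu>) = (\<integral>u. (\<Sum>y\<in>S. - k y * (1 - exp (- (u * y)))) \<partial>\<nu>)"
    using space_pos_borel[OF sets] f0
    by (intro Bochner_Integration.integral_cong refl)
      (simp add: f_def expo_comb_ennreal sum_subtractf sum_negf algebra_simps)
  also have "\<dots> = (\<Sum>y\<in>S. - k y * (\<integral>u. (1 - exp (- (u * y))) \<partial>\<nu>))"
    using int1 by (subst Bochner_Integration.integral_sum) auto
  finally have I: "(\<integral>u. (f (ennreal u) - f 0) \<partial>\<nu>)
      = (\<Sum>y\<in>S. - k y * (\<integral>u. (1 - exp (- (u * y))) \<partial>\<nu>))" .
  show ?thesis
    unfolding I unfolding f0 unfolding f_def vector_derivative_expo_comb_0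
    by (simp add: sum_distrib_left sum_negf flip: sum.distrib sum_subtractf)
      (simp add: algebra_simps sum.distrib sum_negf sum_subtractf)
qed

text \<open>The symbol of a pregenerator is an exponent at every interior point, and is nonpositive at
  the boundary point \<open>0\<close>.\<close>

lemma pregenerator_interior_symbol:
  assumes "sp_pregenerator Y" "0 < y"
  shows "\<exists>G\<in>pk_spLp. \<forall>x>0. Y (expo x) (ennreal y) = G x * exp (- (x * y))"
proof -
  obtain \<nu>0 d0 c0 \<nu>' a' b' c' where
    char: "\<forall>x>0. sets (\<nu>' x) = sets pos_borel \<and> integrable (\<nu>' x) (\<lambda>u. min 1 (u\<^sup>2))
        \<and> 0 \<le> a' x \<and> 0 \<le> c' x"
    and form: "\<forall>f\<in>expo_span. Y f \<infinity> = 0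
        \<and> Y f 0 = (\<integral>u. (f (ennreal u) - f 0) \<partial>\<nu>0)
            + d0 * vector_derivative (\<lambda>t. f (ennreal t)) (at 0 within {0..}) - c0 * f 0
        \<and> (\<forall>x>0. Y f (ennreal x) =
              (\<integral>u. (f (ennreal (x + u)) - f (ennreal x)
                     - u * deriv (\<lambda>t. f (ennreal t)) x * indicator {0<..1} u) \<partial>\<nu>' x)
            + a' x * deriv (deriv (\<lambda>t. f (ennreal t))) x
            + b' x * deriv (\<lambda>t. f (ennreal t)) x
            - c' x * f (ennreal x))"
    using assms(1) unfolding sp_pregenerator_def by (elim exE conjE) (rule that; assumption)
  define \<nu> a b c where defs: "\<nu> = \<nu>' y" "a = a' y" "b = b' y" "c = c' y"
  have \<nu>: "levy_measure \<nu>" and ac: "0 \<le> a" "0 \<le> c"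
    using char assms(2) unfolding defs by (simp_all add: levy_measure_def)
  have "Y (expo x) (ennreal y) = lk_exponent \<nu> a b c x * exp (- (x * y))" if "0 < x" for x
  proof -
    have "Y (expo x) (ennreal y) = (\<Sum>z\<in>{x}. 1 * exp (- (y * z)) * lk_exponent \<nu> a b c z)"
      using bspec[OF form expo_in_span[OF that], THEN conjunct2, THEN conjunct2, rule_format, OF assms(2)]
        interior_form_expo_comb[OF \<nu>, of "{x}" y "\<lambda>_. 1" a b c] assms(2) that
      unfolding expo_eq_comb[symmetric] defs[symmetric] by simp
    then show ?thesis by (simp add: mult_ac)
  qed
  moreover have "lk_exponent \<nu> a b c \<in> pk_spLp" unfolding pk_spLp_iff using \<nu> ac by blast
  ultimately show ?thesis by blast
qed

lemma pregenerator_boundary_symbol_nonpos: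
  assumes "sp_pregenerator Y" "0 < x"
  shows "Y (expo x) 0 \<le> 0"
proof -
  obtain \<nu>0 d0 c0 \<nu>' a' b' c' where
    sets: "sets \<nu>0 = sets pos_borel" and int: "integrable \<nu>0 (\<lambda>u. min 1 u)"
    and dc: "0 \<le> d0" "0 \<le> c0"
    and form: "\<forall>f\<in>expo_span. Y f \<infinity> = 0
        \<and> Y f 0 = (\<integral>u. (f (ennreal u) - f 0) \<partial>\<nu>0)
            + d0 * vector_derivative (\<lambda>t. f (ennreal t)) (at 0 within {0..}) - c0 * f 0
        \<and> (\<forall>x>0. Y f (ennreal x) =
              (\<integral>u. (f (ennreal (x + u)) - f (ennreal x)
                     - u * deriv (\<lambda>t. f (ennreal t)) x * indicator {0<..1} u) \<partial>\<nu>' x)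
            + a' x * deriv (deriv (\<lambda>t. f (ennreal t))) x
            + b' x * deriv (\<lambda>t. f (ennreal t)) x
            - c' x * f (ennreal x))"
    using assms(1) unfolding sp_pregenerator_def by (elim exE conjE) (rule that; assumption)
  have "Y (expo x) 0 = (\<Sum>z\<in>{x}. 1 * - ((\<integral>u. (1 - exp (- (u * z))) \<partial>\<nu>0) + d0 * z + c0))"
    using bspec[OF form expo_in_span[OF assms(2)], THEN conjunct2, THEN conjunct1]
      boundary_form_expo_comb[OF sets int, of "{x}" "\<lambda>_. 1" d0 c0] assms(2)
    unfolding expo_eq_comb[symmetric] by simp
  moreover have "0 \<le> (\<integral>u. (1 - exp (- (u * x))) \<partial>\<nu>0)"
    using assms(2) space_pos_borel[OF sets] by (intro integral_nonneg_AE AE_I2) simp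
  moreover have "0 \<le> d0 * x" using dc assms(2) by simp
  ultimately show ?thesis using dc by simp
qed

lemma continuous_at_zero_tendsto:
  assumes "continuous_at_zero Y" "0 < x"
  shows "((\<lambda>t. Y (expo x) (ennreal t)) \<longlongrightarrow> Y (expo x) 0) (at_right 0)"
proof -
  have "isCont (Y (expo x)) 0"
    using assms expo_in_span unfolding continuous_at_zero_def by blast
  moreover have "(ennreal \<longlongrightarrow> ennreal 0) (at_right 0)"
    by (intro tendsto_ennrealI tendsto_ident_at)
  ultimately show ?thesis using isCont_tendsto_compose by fastforce
qed

section \<open>Products of a function and a translation invariant operator\<close>

text \<open>The operator that multiplies \<open>L_op T f\<close> by a function \<open>s\<close> of the state; at the state
  \<open>\<infinity>\<close> the value of \<open>s\<close> is immaterial, as \<open>L_op T f\<close> vanishes there.\<close>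

definition product_op ::
    "(real \<Rightarrow> real) \<Rightarrow> (real \<Rightarrow> real) \<Rightarrow> (ennreal \<Rightarrow> real) \<Rightarrow> ennreal \<Rightarrow> real" where
  "product_op s T f y = s (enn2real y) * L_op T f y"

lemma L_op_expo_ennreal:
  "0 < x \<Longrightarrow> 0 \<le> y \<Longrightarrow> L_op T (expo x) (ennreal y) = T x * exp (- (x * y))"
  by (simp add: L_op_expo expo_def mult.commute)

lemma product_op_expo:
  "0 < x \<Longrightarrow> 0 \<le> y \<Longrightarrow> product_op s T (expo x) (ennreal y) = s y * T x * exp (- (x * y))"
  by (simp add: product_op_def L_op_expo_ennreal)

lemma product_op_continuous_at_zero:
  assumes s: "continuous_on {0..} s"
  shows "continuous_at_zero (product_op s T)"
  unfolding continuous_at_zero_def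
proof
  fix f assume "f \<in> expo_span"
  then obtain S k where S: "finite S" "S \<subseteq> {0<..}" and f: "f = expo_comb S k"
    unfolding expo_span_def by blast
  define h where "h t = s (max 0 t) * (\<Sum>y\<in>S. T y * k y * exp (- (t * y)))" for t
  have eq: "product_op s T f u = h (enn2real u)" if "u \<noteq> \<infinity>" for u
    using that unfolding product_op_def f L_op_expo_comb[OF S] h_def
    by (simp add: expo_comb_def expo_def)
  have "continuous_on UNIV (\<lambda>t. s (max 0 t))"
    by (rule continuous_on_compose2[OF s]) (auto intro!: continuous_intros)
  then have "continuous_on UNIV h"
    unfolding h_def by (intro continuous_intros)
  then have "isCont h 0" by (simp add: continuous_on_eq_continuous_at)
  moreover have "(enn2real \<longlongrightarrow> 0) (at 0)"
    using tendsto_enn2real[of "\<lambda>u. u" 0 "at (0::ennreal)"] by (simp add: tendsto_ident_at)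
  ultimately have lim: "((\<lambda>u. h (enn2real u)) \<longlongrightarrow> h 0) (at (0::ennreal))"
    by (rule isCont_tendsto_compose)
  have "\<forall>\<^sub>F u in at (0::ennreal). u < \<infinity>"
    by (intro order_tendstoD(2)[OF tendsto_ident_at]) simp
  then have "\<forall>\<^sub>F u in at 0. h (enn2real u) = product_op s T f u"
    by (rule eventually_mono) (metis eq less_irrefl)
  from Lim_transform_eventually[OF lim this]
  show "isCont (product_op s T f) 0" using eq[of 0] by (simp add: isCont_def)
qed

text \<open>Such an operator is a pregenerator as soon as its symbol \<open>s y * T x\<close> is, in \<open>x\<close>, an exponent
  with measurable characteristics at interior states \<open>y\<close>, and the negative of a member of \<open>pk_subo\<close>
  at the state \<open>0\<close>.\<close>

lemma product_op_pregenerator: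
  assumes interior: "\<And>y. 0 < y \<Longrightarrow> levy_measure (\<nu> y) \<and> 0 \<le> a y \<and> 0 \<le> c y
        \<and> (\<forall>x>0. s y * T x = lk_exponent (\<nu> y) (a y) (b y) (c y) x)"
    and boundary: "(\<lambda>x. - (s 0 * T x)) \<in> pk_subo"
    and meas: "a \<in> borel_measurable pos_borel" "b \<in> borel_measurable pos_borel"
      "c \<in> borel_measurable pos_borel"
      "\<And>g. g \<in> borel_measurable pos_borel \<Longrightarrow>
          (\<lambda>y. \<integral>u. g u * min 1 (u\<^sup>2) \<partial>\<nu> y) \<in> borel_measurable pos_borel"
  shows "sp_pregenerator (product_op s T)"
proof -
  obtain \<nu>0 d0 c0 where \<nu>0: "sets \<nu>0 = sets pos_borel" "integrable \<nu>0 (\<lambda>u. min 1 u)"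
    and dc0: "0 \<le> d0" "0 \<le> c0"
    and eq0: "\<forall>x\<ge>0. - (s 0 * T x) = (\<integral>u. (1 - exp (- (u * x))) \<partial>\<nu>0) + d0 * x + c0"
    using boundary unfolding pk_subo_def by blast
  have form: "\<forall>f\<in>expo_span. product_op s T f \<infinity> = 0
        \<and> product_op s T f 0 = (\<integral>u. (f (ennreal u) - f 0) \<partial>\<nu>0)
            + d0 * vector_derivative (\<lambda>t. f (ennreal t)) (at 0 within {0..}) - c0 * f 0
        \<and> (\<forall>x>0. product_op s T f (ennreal x) =
              (\<integral>u. (f (ennreal (x + u)) - f (ennreal x)
                     - u * deriv (\<lambda>t. f (ennreal t)) x * indicator {0<..1} u) \<partial>\<nu> x)
            + a x * deriv (deriv (\<lambda>t. f (ennreal t))) x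
            + b x * deriv (\<lambda>t. f (ennreal t)) x
            - c x * f (ennreal x))"
  proof (intro ballI conjI)
    fix f assume "f \<in> expo_span"
    then obtain S k where S: "finite S" "S \<subseteq> {0<..}" and f: "f = expo_comb S k"
      unfolding expo_span_def by blast
    show "product_op s T f \<infinity> = 0"
      unfolding product_op_def f L_op_expo_comb[OF S] by (simp add: expo_comb_def expo_def)
    have "product_op s T f 0 = (\<Sum>y\<in>S. k y * (s 0 * T y))"
      unfolding product_op_def f L_op_expo_comb[OF S]
      using expo_comb_ennreal[of 0 S "\<lambda>y. T y * k y"] by (simp add: sum_distrib_left mult_ac)
    also have "\<dots> = (\<Sum>y\<in>S. k y * - ((\<integral>u. (1 - exp (- (u * y))) \<partial>\<nu>0) + d0 * y + c0))"
    proof (rule sum.cong[OF refl])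
      fix y assume "y \<in> S"
      then have "0 \<le> y" using S by auto
      then have "s 0 * T y = - ((\<integral>u. (1 - exp (- (u * y))) \<partial>\<nu>0) + d0 * y + c0)"
        using eq0[rule_format, of y] by linarith
      then show "k y * (s 0 * T y) = k y * - ((\<integral>u. (1 - exp (- (u * y))) \<partial>\<nu>0) + d0 * y + c0)"
        by simp
    qed
    also have "\<dots> = (\<integral>u. (f (ennreal u) - f 0) \<partial>\<nu>0)
            + d0 * vector_derivative (\<lambda>t. f (ennreal t)) (at 0 within {0..}) - c0 * f 0"
      unfolding f by (rule boundary_form_expo_comb[OF \<nu>0 S, symmetric])
    finally show "product_op s T f 0 = (\<integral>u. (f (ennreal u) - f 0) \<partial>\<nu>0)
            + d0 * vector_derivative (\<lambda>t. f (ennreal t)) (at 0 within {0..}) - c0 * f 0" .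
    show "\<forall>x>0. product_op s T f (ennreal x) =
              (\<integral>u. (f (ennreal (x + u)) - f (ennreal x)
                     - u * deriv (\<lambda>t. f (ennreal t)) x * indicator {0<..1} u) \<partial>\<nu> x)
            + a x * deriv (deriv (\<lambda>t. f (ennreal t))) x
            + b x * deriv (\<lambda>t. f (ennreal t)) x
            - c x * f (ennreal x)"
    proof (intro allI impI)
      fix x :: real assume x: "0 < x"
      have "product_op s T f (ennreal x) = (\<Sum>y\<in>S. k y * exp (- (x * y)) * (s x * T y))"
        unfolding product_op_def f L_op_expo_comb[OF S] using x
        by (simp add: expo_comb_ennreal sum_distrib_left mult_ac)
      also have "\<dots> = (\<Sum>y\<in>S. k y * exp (- (x * y)) * lk_exponent (\<nu> x) (a x) (b x) (c x) y)"
        using interior[OF x] S by (intro sum.cong refl) auto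
      also have "\<dots> = (\<integral>u. (f (ennreal (x + u)) - f (ennreal x)
                     - u * deriv (\<lambda>t. f (ennreal t)) x * indicator {0<..1} u) \<partial>\<nu> x)
            + a x * deriv (deriv (\<lambda>t. f (ennreal t))) x
            + b x * deriv (\<lambda>t. f (ennreal t)) x
            - c x * f (ennreal x)"
        unfolding f using interior[OF x] by (intro interior_form_expo_comb[symmetric] S x) simp
      finally show "product_op s T f (ennreal x) = \<dots>" .
    qed
  qed
  have char: "\<forall>x>0. sets (\<nu> x) = sets pos_borel \<and> integrable (\<nu> x) (\<lambda>u. min 1 (u\<^sup>2))
      \<and> 0 \<le> a x \<and> 0 \<le> c x"
    using interior by (simp add: levy_measure_def)
  have kernels: "\<forall>g\<in>borel_measurable pos_borel. bounded (g ` {0<..}) \<longrightarrow>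
      (\<lambda>x. \<integral>u. g u * min 1 (u\<^sup>2) \<partial>\<nu> x) \<in> borel_measurable pos_borel"
    by (intro ballI impI meas(4))
  show ?thesis
    unfolding sp_pregenerator_def
    by (rule exI[of _ \<nu>0], rule exI[of _ d0], rule exI[of _ c0], rule exI[of _ \<nu>],
        rule exI[of _ a], rule exI[of _ b], rule exI[of _ c])
      (intro conjI \<nu>0 dc0 char meas(1,2,3) kernels form)
qed

lemma borel_measurable_pos_borel: "f \<in> borel_measurable borel \<Longrightarrow> f \<in> borel_measurable pos_borel"
  by (rule borel_measurable_pos[OF refl])

lemma linear_in_pk_subo: "0 \<le> d \<Longrightarrow> (\<lambda>y. d * y) \<in> pk_subo"
  unfolding pk_subo_def
  by (rule CollectI, rule exI[of _ "null_measure pos_borel"], rule exI[of _ d], rule exI[of _ 0])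
    (auto intro!: borel_measurable_pos_borel)

text \<open>Multiplication of a measure by a nonnegative constant is expressed as a constant density.\<close>

lemma
  fixes r :: real
  assumes sets: "sets \<nu> = sets pos_borel" and f: "f \<in> borel_measurable pos_borel" and r: "0 \<le> r"
  shows integral_scaled: "(\<integral>u. f u \<partial>density \<nu> (\<lambda>_. ennreal r)) = r * (\<integral>u. f u \<partial>\<nu>)"
    and integrable_scaled: "integrable \<nu> f \<Longrightarrow> integrable (density \<nu> (\<lambda>_. ennreal r)) f"
proof -
  have f': "f \<in> borel_measurable \<nu>" using f sets by (simp cong: measurable_cong_sets)
  show "(\<integral>u. f u \<partial>density \<nu> (\<lambda>_. ennreal r)) = r * (\<integral>u. f u \<partial>\<nu>)"
    using integral_density[OF f', of "\<lambda>_. r"] r by simp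
  show "integrable (density \<nu> (\<lambda>_. ennreal r)) f" if "integrable \<nu> f"
    using integrable_density[OF f', of "\<lambda>_. r"] r that by simp
qed

lemma levy_measure_scaled:
  assumes "levy_measure \<nu>" "0 \<le> r"
  shows "levy_measure (density \<nu> (\<lambda>_. ennreal r))"
  using assms unfolding levy_measure_def
  by (auto intro!: integrable_scaled borel_measurable_pos_borel)

lemma lk_exponent_scaled:
  assumes "levy_measure \<nu>" "0 \<le> r"
  shows "lk_exponent (density \<nu> (\<lambda>_. ennreal r)) (r * a) (r * b) (r * c) y
      = r * lk_exponent \<nu> a b c y"
proof -
  have "(\<integral>u. lk_kernel y u \<partial>density \<nu> (\<lambda>_. ennreal r)) = r * (\<integral>u. lk_kernel y u \<partial>\<nu>)"
    using assms by (intro integral_scaled borel_measurable_pos_borel) (auto simp: levy_measure_def)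
  then show ?thesis by (simp add: lk_exponent_def algebra_simps)
qed

lemma pk_spLp_scale:
  assumes "\<Psi> \<in> pk_spLp" "0 \<le> r"
  shows "(\<lambda>y. r * \<Psi> y) \<in> pk_spLp"
proof -
  obtain \<nu> a b c where \<nu>: "levy_measure \<nu>" and ac: "0 \<le> a" "0 \<le> c"
    and eq: "\<forall>y\<ge>0. \<Psi> y = lk_exponent \<nu> a b c y"
    using assms(1) unfolding pk_spLp_iff by blast
  have "\<forall>y\<ge>0. r * \<Psi> y = lk_exponent (density \<nu> (\<lambda>_. ennreal r)) (r * a) (r * b) (r * c) y"
    using eq lk_exponent_scaled[OF \<nu> assms(2)] by simp
  moreover have "0 \<le> r * a" "0 \<le> r * c" using ac assms(2) by simp_all
  ultimately show ?thesis
    unfolding pk_spLp_iff using levy_measure_scaled[OF \<nu> assms(2)] by blast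
qed

lemma pk_subo_scale:
  assumes "\<Phi> \<in> pk_subo" "0 \<le> r"
  shows "(\<lambda>y. r * \<Phi> y) \<in> pk_subo"
proof -
  have "(\<lambda>y. r * (- \<Phi> y)) \<in> pk_spLp"
    by (rule pk_spLp_scale[OF uminus_pk_subo_in_pk_spLp[OF assms(1)] assms(2)])
  moreover have "r * (- \<Phi> y) \<le> 0" if "0 \<le> y" for y
    using pk_subo_nonneg[OF assms(1) that] assms(2) by simp
  ultimately show ?thesis using pk_spLp_nonpos_imp_pk_subo by fastforce
qed

lemma product_op_pregenerator_nonneg:
  assumes T: "T \<in> pk_spLp" and s: "continuous_on {0..} s" "\<And>y. 0 \<le> y \<Longrightarrow> 0 \<le> s y"
    and boundary: "(\<lambda>x. - (s 0 * T x)) \<in> pk_subo"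
  shows "sp_pregenerator (product_op s T)"
proof -
  obtain \<nu> a b c where \<nu>: "levy_measure \<nu>" and ac: "0 \<le> a" "0 \<le> c"
    and eq: "\<forall>x\<ge>0. T x = lk_exponent \<nu> a b c x"
    using T unfolding pk_spLp_iff by blast
  have sets: "sets \<nu> = sets pos_borel" using \<nu> by (simp add: levy_measure_def)
  have s_meas [measurable]: "s \<in> borel_measurable pos_borel"
    unfolding pos_borel_def
    by (rule borel_measurable_continuous_on_restrict[OF continuous_on_subset[OF s(1)]]) auto
  show ?thesis
  proof (rule product_op_pregenerator[where \<nu> = "\<lambda>y. density \<nu> (\<lambda>_. ennreal (s y))"
        and a = "\<lambda>y. s y * a" and b = "\<lambda>y. s y * b" and c = "\<lambda>y. s y * c"])
    fix y :: real assume "0 < y"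
    then have sy: "0 \<le> s y" using s(2) by simp
    then show "levy_measure (density \<nu> (\<lambda>_. ennreal (s y))) \<and> 0 \<le> s y * a \<and> 0 \<le> s y * c \<and>
        (\<forall>x>0. s y * T x = lk_exponent (density \<nu> (\<lambda>_. ennreal (s y))) (s y * a) (s y * b) (s y * c) x)"
      using levy_measure_scaled[OF \<nu> sy] lk_exponent_scaled[OF \<nu> sy] ac eq by simp
  next
    fix g :: "real \<Rightarrow> real" assume g: "g \<in> borel_measurable pos_borel"
    have w: "(\<lambda>u. min 1 (u\<^sup>2)) \<in> borel_measurable pos_borel"
      by (rule borel_measurable_pos_borel) measurable
    have "(\<integral>u. g u * min 1 (u\<^sup>2) \<partial>density \<nu> (\<lambda>_. ennreal (s y)))
        = s y * (\<integral>u. g u * min 1 (u\<^sup>2) \<partial>\<nu>)" if "y \<in> space pos_borel" for y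
      using that s(2)[of y] space_pos_borel[OF refl] g w
      by (intro integral_scaled[OF sets]) auto
    then show "(\<lambda>y. \<integral>u. g u * min 1 (u\<^sup>2) \<partial>density \<nu> (\<lambda>_. ennreal (s y)))
        \<in> borel_measurable pos_borel"
      by (subst measurable_cong) (assumption, measurable)
  qed (use boundary in measurable)
qed

text \<open>A pure drift may carry a factor of either sign.\<close>

lemma product_op_pregenerator_drift:
  assumes s: "continuous_on {0..} s" "0 \<le> \<gamma> * s 0"
  shows "sp_pregenerator (product_op s (\<lambda>x. - (\<gamma> * x)))"
proof -
  have [measurable]: "s \<in> borel_measurable pos_borel"
    unfolding pos_borel_def
    by (rule borel_measurable_continuous_on_restrict[OF continuous_on_subset[OF s(1)]]) auto
  show ?thesis
  proof (rule product_op_pregenerator[where \<nu> = "\<lambda>_. null_measure pos_borel"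
        and a = "\<lambda>_. 0" and b = "\<lambda>y. \<gamma> * s y" and c = "\<lambda>_. 0"])
    show "(\<lambda>x. - (s 0 * - (\<gamma> * x))) \<in> pk_subo"
      using linear_in_pk_subo[OF s(2)] by (simp add: mult_ac)
  qed (simp_all add: levy_measure_def lk_exponent_def borel_measurable_pos_borel)
qed

section \<open>Duality of product operators\<close>

lemma product_form_dual_iff:
  assumes "\<forall>f\<in>expo_span. \<forall>x\<ge>0. X f (ennreal x) = R x * L_op \<Psi> f (ennreal x)"
  shows "laplace_dual X Y \<longleftrightarrow>
    (\<forall>x>0. \<forall>y>0. Y (expo x) (ennreal y) = R x * \<Psi> y * exp (- (x * y)))"
proof -
  have eq: "X (expo y) (ennreal x) = R x * \<Psi> y * exp (- (x * y))" if "0 < x" "0 < y" for x y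
    using assms expo_in_span[OF that(2)] that by (simp add: L_op_expo expo_def mult_ac)
  show ?thesis unfolding laplace_dual_def by (auto simp: eq)
qed

lemma continuous_on_tendsto_at_right_0:
  fixes f :: "real \<Rightarrow> real"
  assumes "continuous_on {0..} f"
  shows "(f \<longlongrightarrow> f 0) (at_right 0)"
proof -
  have "(f \<longlongrightarrow> f 0) (at 0 within {0..})" using assms by (simp add: continuous_on_def)
  then show ?thesis by (simp add: at_within_Ici_at_right)
qed

text \<open>An open condition that a continuous function meets on \<open>[0,\<infinity>)\<close> is met on \<open>(0,\<infinity>)\<close>.\<close>

lemma continuous_on_open_value_at_pos:
  fixes f :: "real \<Rightarrow> real"
  assumes f: "continuous_on {0..} f" and y: "0 \<le> y" and U: "open U" "f y \<in> U"
  shows "\<exists>z>0. f z \<in> U"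
proof (cases "y = 0")
  case True
  have "(f \<longlongrightarrow> f 0) (at_right 0)"
    by (rule continuous_on_tendsto_at_right_0[OF f])
  then have "\<forall>\<^sub>F z in at_right 0. f z \<in> U" using U True by (simp add: topological_tendstoD)
  moreover have "\<forall>\<^sub>F z::real in at_right 0. 0 < z" by (rule eventually_at_right_less)
  ultimately have "\<forall>\<^sub>F z in at_right 0. 0 < z \<and> f z \<in> U" by eventually_elim simp
  from eventually_happens'[OF trivial_limit_at_right_real this] show ?thesis .
next
  case False
  then show ?thesis using y U by (intro exI[of _ y]) simp
qed

text \<open>Continuity at zero propagates the product form from interior states to the state \<open>0\<close>.\<close>

lemma product_form_dual_iff_closed:
  assumes form: "\<forall>f\<in>expo_span. \<forall>x\<ge>0. X f (ennreal x) = R x * L_op \<Psi> f (ennreal x)"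
    and Y: "continuous_at_zero Y" and \<Psi>: "continuous_on {0..} \<Psi>"
  shows "laplace_dual X Y \<longleftrightarrow>
    (\<forall>x>0. \<forall>y\<ge>0. Y (expo x) (ennreal y) = R x * \<Psi> y * exp (- (x * y)))" (is "_ \<longleftrightarrow> ?closed")
proof
  show "laplace_dual X Y" if ?closed
    using that unfolding product_form_dual_iff[OF form] by simp
  assume "laplace_dual X Y"
  then have inner: "Y (expo x) (ennreal y) = R x * \<Psi> y * exp (- (x * y))" if "0 < x" "0 < y" for x y
    using that unfolding product_form_dual_iff[OF form] by blast
  show ?closed
  proof (intro allI impI)
    fix x y :: real assume x: "0 < x" and y: "0 \<le> y"
    show "Y (expo x) (ennreal y) = R x * \<Psi> y * exp (- (x * y))"
    proof (cases "y = 0")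
      case False
      then show ?thesis using inner x y by simp
    next
      case True
      have "\<forall>\<^sub>F t in at_right 0. Y (expo x) (ennreal t) = product_op \<Psi> R (expo x) (ennreal t)"
        by (rule eventually_mono[OF eventually_at_right_less])
          (use inner x product_op_expo in \<open>simp add: mult.commute\<close>)
      with continuous_at_zero_tendsto[OF Y x]
      have "((\<lambda>t. product_op \<Psi> R (expo x) (ennreal t)) \<longlongrightarrow> Y (expo x) 0) (at_right 0)"
        by (rule Lim_transform_eventually)
      from tendsto_unique[OF _ this
          continuous_at_zero_tendsto[OF product_op_continuous_at_zero[OF \<Psi>] x]]
      have "Y (expo x) (ennreal 0) = product_op \<Psi> R (expo x) (ennreal 0)" by simp
      then show ?thesis using True x by (simp only: product_op_expo order_refl mult.commute)
    qed
  qed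
qed

text \<open>The necessary condition on the multiplier: at a state where \<open>\<Psi>\<close> does not vanish, the
  symbol of the dual is a nonzero multiple of the multiplier. Here \<open>e\<close> has the sign of \<open>\<Psi> y\<close>.\<close>

lemma dual_multiplier_exponent:
  assumes Y: "sp_pregenerator Y"
    and dual: "\<forall>x>0. \<forall>y>0. Y (expo x) (ennreal y) = R x * \<Psi> y * exp (- (x * y))"
    and R: "(R \<longlongrightarrow> R 0) (at_right 0)"
    and y: "0 < y" "0 < e * \<Psi> y"
  shows "(\<lambda>x. e * R x) \<in> pk_spLp"
proof -
  obtain G where G: "G \<in> pk_spLp" and Geq: "\<forall>x>0. Y (expo x) (ennreal y) = G x * exp (- (x * y))"
    using pregenerator_interior_symbol[OF Y y(1)] by blast
  define r where "r = e / \<Psi> y"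
  have r: "0 \<le> r" using y(2) unfolding r_def by (auto simp: zero_less_mult_iff zero_le_divide_iff)
  have H: "(\<lambda>x. r * G x) \<in> pk_spLp" by (rule pk_spLp_scale[OF G r])
  have pos: "e * R x = r * G x" if "0 < x" for x
  proof -
    have "G x = R x * \<Psi> y" using dual Geq that y(1) by simp
    moreover have "\<Psi> y \<noteq> 0" using y(2) by auto
    ultimately show ?thesis by (simp add: r_def)
  qed
  moreover have "e * R 0 = r * G 0"
  proof -
    have "((\<lambda>x. r * G x) \<longlongrightarrow> r * G 0) (at_right 0)"
      by (rule continuous_on_tendsto_at_right_0[OF pk_spLp_continuous[OF H]])
    moreover have "\<forall>\<^sub>F x in at_right 0. r * G x = e * R x"
      by (rule eventually_mono[OF eventually_at_right_less]) (use pos in simp)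
    ultimately have "((\<lambda>x. e * R x) \<longlongrightarrow> r * G 0) (at_right 0)"
      by (rule Lim_transform_eventually)
    from tendsto_unique[OF _ tendsto_mult_left[OF R] this] show ?thesis by simp
  qed
  ultimately show ?thesis
    using pos by (intro pk_spLp_cong[OF H]) (auto simp: le_less)
qed

text \<open>Continuity of the pregenerator at zero forces the multiplier to be right-continuous at \<open>0\<close>,
  so that statements about it on \<open>(0,\<infinity>)\<close> extend to \<open>[0,\<infinity>)\<close>.\<close>

lemma multiplier_tendsto_zero:
  assumes X: "continuous_at_zero X"
    and form: "\<forall>f\<in>expo_span. \<forall>x\<ge>0. X f (ennreal x) = R x * L_op \<Psi> f (ennreal x)"
    and y: "0 < y" "\<Psi> y \<noteq> 0"
  shows "(R \<longlongrightarrow> R 0) (at_right 0)"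
proof -
  have eq: "X (expo y) (ennreal x) = R x * \<Psi> y * exp (- (x * y))" if "0 \<le> x" for x
    using form expo_in_span[OF y(1)] that y by (simp add: L_op_expo expo_def)
  have "((\<lambda>x. X (expo y) (ennreal x)) \<longlongrightarrow> R 0 * \<Psi> y) (at_right 0)"
    using continuous_at_zero_tendsto[OF X y(1)] eq[of 0] by simp
  moreover have "((\<lambda>x. exp (x * y) / \<Psi> y) \<longlongrightarrow> exp (0 * y) / \<Psi> y) (at_right 0)"
    by (intro tendsto_intros y(2))
  ultimately have "((\<lambda>x. X (expo y) (ennreal x) * (exp (x * y) / \<Psi> y)) \<longlongrightarrow>
      R 0 * \<Psi> y * (exp (0 * y) / \<Psi> y)) (at_right 0)"
    by (rule tendsto_mult)
  moreover have "\<forall>\<^sub>F x in at_right 0. X (expo y) (ennreal x) * (exp (x * y) / \<Psi> y) = R x"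
  proof (rule eventually_mono[OF eventually_at_right_less])
    fix x :: real assume "0 < x"
    then have "X (expo y) (ennreal x) * (exp (x * y) / \<Psi> y)
        = R x * (exp (x * y) * exp (- (x * y)))"
      using eq[of x] y(2) by simp
    then show "X (expo y) (ennreal x) * (exp (x * y) / \<Psi> y) = R x"
      unfolding exp_minus_inverse by simp
  qed
  ultimately have "(R \<longlongrightarrow> R 0 * \<Psi> y * (exp (0 * y) / \<Psi> y)) (at_right 0)"
    by (rule Lim_transform_eventually)
  then show ?thesis using y(2) by simp
qed

lemma product_form_symbols:
  assumes form: "\<forall>f\<in>expo_span. \<forall>x\<ge>0. X f (ennreal x) = R x * L_op \<Psi> f (ennreal x)"
    and dual: "laplace_dual X Y" and "0 < x" "0 < y"
  shows "laplace_symbol X (ennreal x) y = R x * \<Psi> y" "laplace_symbol Y (ennreal y) x = R x * \<Psi> y"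
proof -
  have X: "X (expo y) (ennreal x) = R x * \<Psi> y * exp (- (x * y))"
    using form expo_in_span[OF assms(4)] assms(3,4) by (simp add: L_op_expo expo_def)
  then have "Y (expo x) (ennreal y) = R x * \<Psi> y * exp (- (x * y))"
    using dual assms(3,4) by (simp add: laplace_dual_def)
  with X show "laplace_symbol X (ennreal x) y = R x * \<Psi> y"
    "laplace_symbol Y (ennreal y) x = R x * \<Psi> y"
    using assms(3,4) exp_minus_inverse[of "x * y"] by (simp_all add: laplace_symbol_def mult_ac)
qed

section \<open>The classification of duals\<close>

theorem theorem4p9:
  fixes X :: "(ennreal \<Rightarrow> real) \<Rightarrow> ennreal \<Rightarrow> real"
    and \<Psi> R :: "real \<Rightarrow> real"
  assumes X_pregen: "sp_pregenerator X"
    and X_cont: "continuous_at_zero X"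
    and Psi: "\<Psi> \<in> pk_spLp"
    and R_meas: "R \<in> borel_measurable (restrict_space borel {0..})"
    and R_nonneg: "\<forall>x\<ge>0. 0 \<le> R x"
    and Psi_nz: "\<exists>y\<ge>0. \<Psi> y \<noteq> 0"
    and R_nz: "\<exists>x\<ge>0. R x \<noteq> 0"
    and X_form: "\<forall>f\<in>expo_span. \<forall>x\<ge>0. X f (ennreal x) = R x * L_op \<Psi> f (ennreal x)"
  shows
    "((\<forall>y\<ge>0. 0 \<le> \<Psi> y) \<longrightarrow>
        ((\<exists>Y. sp_pregenerator Y \<and> continuous_at_zero Y \<and> laplace_dual X Y) \<longleftrightarrow>
           (\<exists>\<Sigma>\<in>spLp_nonup. \<exists>\<Sigma>'\<in>spLp_nonup. (\<forall>y\<ge>0. \<Psi> y = \<Sigma> y) \<and> (\<forall>x\<ge>0. R x = \<Sigma>' x)))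
      \<and> (\<forall>Y. sp_pregenerator Y \<and> continuous_at_zero Y \<longrightarrow>
           (laplace_dual X Y \<longleftrightarrow>
             (\<exists>\<Sigma>\<in>spLp_nonup. \<exists>\<Sigma>'\<in>spLp_nonup. (\<forall>y\<ge>0. \<Psi> y = \<Sigma> y) \<and> (\<forall>x\<ge>0. R x = \<Sigma>' x)
                \<and> (\<forall>x>0. \<forall>y\<ge>0. Y (expo x) (ennreal y) = \<Sigma> y * L_op \<Sigma>' (expo x) (ennreal y)))))
      \<and> (\<forall>Y. sp_pregenerator Y \<and> continuous_at_zero Y \<and> laplace_dual X Y \<longrightarrow>
           (\<forall>\<Sigma>\<in>spLp_nonup. \<forall>\<Sigma>'\<in>spLp_nonup.
              (\<forall>y\<ge>0. \<Psi> y = \<Sigma> y) \<and> (\<forall>x\<ge>0. R x = \<Sigma>' x) \<longrightarrow>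
              (\<forall>x>0. \<forall>y>0. laplace_symbol X (ennreal x) y = \<Sigma>' x * \<Sigma> y
                         \<and> laplace_symbol Y (ennreal y) x = \<Sigma>' x * \<Sigma> y))))
   \<and> ((\<forall>y\<ge>0. \<Psi> y \<le> 0) \<longrightarrow>
        ((\<exists>Y. sp_pregenerator Y \<and> continuous_at_zero Y \<and> laplace_dual X Y) \<longleftrightarrow>
           (\<exists>\<Phi>\<in>pk_subo. \<exists>\<Phi>'\<in>pk_subo. (\<forall>y\<ge>0. \<Psi> y = - \<Phi> y) \<and> (\<forall>x\<ge>0. R x = \<Phi>' x)))
      \<and> (\<forall>Y. sp_pregenerator Y \<and> continuous_at_zero Y \<longrightarrow>
           (laplace_dual X Y \<longleftrightarrow>
             (\<exists>\<Phi>\<in>pk_subo. \<exists>\<Phi>'\<in>pk_subo. (\<forall>y\<ge>0. \<Psi> y = - \<Phi> y) \<and> (\<forall>x\<ge>0. R x = \<Phi>' x)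
                \<and> (\<forall>x>0. \<forall>y\<ge>0. Y (expo x) (ennreal y)
                       = \<Phi> y * L_op (\<lambda>z. - \<Phi>' z) (expo x) (ennreal y)))))
      \<and> (\<forall>Y. sp_pregenerator Y \<and> continuous_at_zero Y \<and> laplace_dual X Y \<longrightarrow>
           (\<forall>\<Phi>\<in>pk_subo. \<forall>\<Phi>'\<in>pk_subo.
              (\<forall>y\<ge>0. \<Psi> y = - \<Phi> y) \<and> (\<forall>x\<ge>0. R x = \<Phi>' x) \<longrightarrow>
              (\<forall>x>0. \<forall>y>0. laplace_symbol X (ennreal x) y = - \<Phi>' x * \<Phi> y
                         \<and> laplace_symbol Y (ennreal y) x = - \<Phi>' x * \<Phi> y))))
   \<and> (\<not> (\<forall>y\<ge>0. 0 \<le> \<Psi> y) \<and> \<not> (\<forall>y\<ge>0. \<Psi> y \<le> 0) \<longrightarrow>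
        ((\<exists>Y. sp_pregenerator Y \<and> continuous_at_zero Y \<and> laplace_dual X Y) \<longleftrightarrow>
           (\<exists>\<gamma>>0. \<forall>x\<ge>0. R x = \<gamma> * x))
      \<and> (\<forall>Y. sp_pregenerator Y \<and> continuous_at_zero Y \<longrightarrow>
           (laplace_dual X Y \<longleftrightarrow>
             (\<exists>\<gamma>>0. (\<forall>x\<ge>0. R x = \<gamma> * x)
                \<and> (\<forall>x>0. \<forall>y\<ge>0. Y (expo x) (ennreal y)
                       = - \<Psi> y * L_op (\<lambda>z. - (\<gamma> * z)) (expo x) (ennreal y)))))
      \<and> (\<forall>Y. sp_pregenerator Y \<and> continuous_at_zero Y \<and> laplace_dual X Y \<longrightarrow>
           (\<forall>\<gamma>>0. (\<forall>x\<ge>0. R x = \<gamma> * x) \<longrightarrow>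
              (\<forall>x>0. \<forall>y>0. laplace_symbol X (ennreal x) y = \<gamma> * x * \<Psi> y
                         \<and> laplace_symbol Y (ennreal y) x = \<gamma> * x * \<Psi> y))))"
proof -
  let ?good = "\<lambda>Y. sp_pregenerator Y \<and> continuous_at_zero Y"
  have \<Psi>_cont: "continuous_on {0..} \<Psi>" by (rule pk_spLp_continuous[OF Psi])
  note interior_state = continuous_on_open_value_at_pos[OF \<Psi>_cont]
  obtain y1 where y1: "0 < y1" "\<Psi> y1 \<noteq> 0"
    using Psi_nz interior_state[of _ "- {0}"] by auto
  have R_lim: "(R \<longlongrightarrow> R 0) (at_right 0)"
    by (rule multiplier_tendsto_zero[OF X_cont X_form y1])
  have dual_iff: "laplace_dual X Y \<longleftrightarrow>
      (\<forall>x>0. \<forall>y\<ge>0. Y (expo x) (ennreal y) = R x * \<Psi> y * exp (- (x * y)))" if "?good Y" for Y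
    using that by (intro product_form_dual_iff_closed[OF X_form _ \<Psi>_cont]) simp
  have exponent: "(\<lambda>x. e * R x) \<in> pk_spLp"
    if "?good Y" "laplace_dual X Y" "0 < y" "0 < e * \<Psi> y" for Y y e
    using dual_multiplier_exponent[OF _ iffD1[OF product_form_dual_iff[OF X_form] that(2)] R_lim that(3,4)]
      that(1) by simp
  \<comment> \<open>The two signs \<open>e = 1\<close> and \<open>e = - 1\<close> give the same symbol, but different factors.\<close>
  have product_dual: "laplace_dual X (product_op (\<lambda>y. e * \<Psi> y) (\<lambda>x. e * R x))" if "e * e = 1" for e
  proof -
    have "(e * \<Psi> y) * (e * R x) = R x * \<Psi> y" for x y
    proof -
      have "(e * \<Psi> y) * (e * R x) = (e * e) * (R x * \<Psi> y)" by (simp only: mult_ac)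
      then show ?thesis using that by simp
    qed
    then show ?thesis unfolding product_form_dual_iff[OF X_form] by (simp add: product_op_expo)
  qed
  have product_cont: "continuous_at_zero (product_op (\<lambda>y. e * \<Psi> y) T)" for e T
    by (intro product_op_continuous_at_zero continuous_intros \<Psi>_cont)
  have symbols: "laplace_symbol X (ennreal x) y = R x * \<Psi> y \<and>
      laplace_symbol Y (ennreal y) x = R x * \<Psi> y" if "laplace_dual X Y" "0 < x" "0 < y" for Y x y
    using product_form_symbols[OF X_form that] by simp

  have part1: "((\<exists>Y. ?good Y \<and> laplace_dual X Y) \<longleftrightarrow> R \<in> spLp_nonup) \<and> \<Psi> \<in> spLp_nonup \<and>
      (\<forall>Y. ?good Y \<and> laplace_dual X Y \<longrightarrow> R \<in> spLp_nonup)" if nonneg: "\<forall>y\<ge>0. 0 \<le> \<Psi> y"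
  proof -
    have \<Psi>: "\<Psi> \<in> spLp_nonup" by (rule pk_spLp_nonneg_imp_spLp_nonup[OF Psi]) (use nonneg in simp)
    have nec: "R \<in> spLp_nonup" if "?good Y" "laplace_dual X Y" for Y
    proof (rule pk_spLp_nonneg_imp_spLp_nonup)
      have "0 < 1 * \<Psi> y1" using nonneg y1 by (simp add: order.strict_iff_order)
      then show "R \<in> pk_spLp" using exponent[OF that y1(1), of 1] by simp
    qed (use R_nonneg in simp)
    have "?good (product_op \<Psi> R)" if "R \<in> spLp_nonup"
    proof
      have "\<Psi> 0 = 0" using spLp_nonup_at_zero[OF \<Psi>] .
      then show "sp_pregenerator (product_op \<Psi> R)"
        using nonneg spLp_nonup_subset_pk_spLp[OF that] linear_in_pk_subo[of 0]
        by (intro product_op_pregenerator_nonneg \<Psi>_cont) auto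
      show "continuous_at_zero (product_op \<Psi> R)" using product_cont[of 1] by simp
    qed
    then show ?thesis using nec \<Psi> product_dual[of 1] by auto
  qed
  have part2: "((\<exists>Y. ?good Y \<and> laplace_dual X Y) \<longleftrightarrow> R \<in> pk_subo) \<and> (\<lambda>y. - \<Psi> y) \<in> pk_subo \<and>
      (\<forall>Y. ?good Y \<and> laplace_dual X Y \<longrightarrow> R \<in> pk_subo)" if nonpos: "\<forall>y\<ge>0. \<Psi> y \<le> 0"
  proof -
    have \<Psi>: "(\<lambda>y. - \<Psi> y) \<in> pk_subo"
      by (rule pk_spLp_nonpos_imp_pk_subo[OF Psi]) (use nonpos in simp)
    have nec: "R \<in> pk_subo" if "?good Y" "laplace_dual X Y" for Y
    proof -
      have "\<Psi> y1 < 0" using nonpos y1 by (simp add: order.strict_iff_order)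
      then have "(\<lambda>x. - R x) \<in> pk_spLp" using exponent[OF that y1(1), of "- 1"] by simp
      from pk_spLp_nonpos_imp_pk_subo[OF this] show ?thesis using R_nonneg by simp
    qed
    have "?good (product_op (\<lambda>y. - \<Psi> y) (\<lambda>x. - R x))" if "R \<in> pk_subo"
    proof
      have "(\<lambda>x. - \<Psi> 0 * R x) \<in> pk_subo"
        by (rule pk_subo_scale[OF that]) (use nonpos in simp)
      then show "sp_pregenerator (product_op (\<lambda>y. - \<Psi> y) (\<lambda>x. - R x))"
        using nonpos uminus_pk_subo_in_pk_spLp[OF that]
        by (intro product_op_pregenerator_nonneg continuous_on_minus \<Psi>_cont) auto
      show "continuous_at_zero (product_op (\<lambda>y. - \<Psi> y) (\<lambda>x. - R x))"
        using product_cont[of "- 1"] by simp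
    qed
    then show ?thesis using nec \<Psi> product_dual[of "- 1"] by auto
  qed
  have part3: "((\<exists>Y. ?good Y \<and> laplace_dual X Y) \<longleftrightarrow> (\<exists>\<gamma>>0. \<forall>x\<ge>0. R x = \<gamma> * x)) \<and>
      (\<forall>Y. ?good Y \<and> laplace_dual X Y \<longrightarrow> (\<exists>\<gamma>>0. \<forall>x\<ge>0. R x = \<gamma> * x))"
    if mixed: "\<not> (\<forall>y\<ge>0. 0 \<le> \<Psi> y)" "\<not> (\<forall>y\<ge>0. \<Psi> y \<le> 0)"
  proof -
    have nec: "\<exists>\<gamma>>0. \<forall>x\<ge>0. R x = \<gamma> * x" if Y: "?good Y" "laplace_dual X Y" for Y
    proof -
      obtain p where p: "0 < p" "0 < \<Psi> p"
        using mixed(2) interior_state[of _ "{0<..}"] unfolding not_all not_imp not_le by auto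
      obtain n where n: "0 < n" "\<Psi> n < 0"
        using mixed(1) interior_state[of _ "{..<0}"] unfolding not_all not_imp not_le by auto
      have "R \<in> pk_spLp" "(\<lambda>x. - R x) \<in> pk_spLp"
        using exponent[OF Y p(1), of 1] exponent[OF Y n(1), of "- 1"] p n by auto
      note affine = pk_spLp_both_signs_affine[OF this]
      \<comment> \<open>The boundary condition of \<open>X\<close> at \<open>0\<close> forbids a positive value \<open>R 0 * \<Psi> p\<close>.\<close>
      have "R 0 * \<Psi> p \<le> 0"
        using pregenerator_boundary_symbol_nonpos[OF X_pregen p(1)]
          X_form[rule_format, OF expo_in_span[OF p(1)], of 0] p(1)
        by (simp add: L_op_expo expo_def)
      then have R0: "R 0 = 0"
        using p(2) R_nonneg[rule_format, of 0] by (simp add: mult_le_0_iff)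
      have lin: "R x = R 1 * x" if "0 \<le> x" for x
        using affine[OF that] R0 by (simp add: mult.commute)
      moreover have "0 < R 1"
      proof -
        obtain x where "0 \<le> x" "R x \<noteq> 0" using R_nz by blast
        then have "R 1 \<noteq> 0" using lin[of x] by auto
        then show ?thesis using R_nonneg by (simp add: order.strict_iff_order)
      qed
      ultimately show ?thesis by blast
    qed
    \<comment> \<open>A pure drift tolerates the changing sign of \<open>- \<Psi>\<close>; at \<open>0\<close> the drift is \<open>- \<gamma> * \<Psi> 0 \<ge> 0\<close>.\<close>
    have "\<exists>Y. ?good Y \<and> laplace_dual X Y" if "0 < \<gamma>" "\<forall>x\<ge>0. R x = \<gamma> * x" for \<gamma>
    proof (intro exI[of _ "product_op (\<lambda>y. - \<Psi> y) (\<lambda>x. - (\<gamma> * x))"] conjI)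
      show "sp_pregenerator (product_op (\<lambda>y. - \<Psi> y) (\<lambda>x. - (\<gamma> * x)))"
        using that(1) pk_spLp_at_zero[OF Psi]
        by (intro product_op_pregenerator_drift continuous_on_minus \<Psi>_cont) (simp add: mult_nonneg_nonpos)
      show "continuous_at_zero (product_op (\<lambda>y. - \<Psi> y) (\<lambda>x. - (\<gamma> * x)))"
        using product_cont[of "- 1"] by simp
      show "laplace_dual X (product_op (\<lambda>y. - \<Psi> y) (\<lambda>x. - (\<gamma> * x)))"
        unfolding product_form_dual_iff[OF X_form] using that(2) by (simp add: product_op_expo mult_ac)
    qed
    then show ?thesis using nec by blast
  qed
  show ?thesis
  proof (intro conjI impI)
    assume nonneg: "\<forall>y\<ge>0. 0 \<le> \<Psi> y"
    have ex: "(\<exists>Y. sp_pregenerator Y \<and> continuous_at_zero Y \<and> laplace_dual X Y) \<longleftrightarrow> R \<in> spLp_nonup"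
      and \<Psi>: "\<Psi> \<in> spLp_nonup" and R: "?good Y \<Longrightarrow> laplace_dual X Y \<Longrightarrow> R \<in> spLp_nonup" for Y
      using part1[OF nonneg] unfolding conj_assoc by blast+
    have classes: "(\<exists>\<Sigma>\<in>spLp_nonup. \<exists>\<Sigma>'\<in>spLp_nonup. (\<forall>y\<ge>0. \<Psi> y = \<Sigma> y) \<and> (\<forall>x\<ge>0. R x = \<Sigma>' x))
        \<longleftrightarrow> R \<in> spLp_nonup"
    proof
      show "R \<in> spLp_nonup" if "\<exists>\<Sigma>\<in>spLp_nonup. \<exists>\<Sigma>'\<in>spLp_nonup.
          (\<forall>y\<ge>0. \<Psi> y = \<Sigma> y) \<and> (\<forall>x\<ge>0. R x = \<Sigma>' x)"
        using that by (elim bexE conjE) (rule spLp_nonup_cong)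
    qed (rule bexI[OF _ \<Psi>], rule bexI[of _ R], simp_all)
    show "(\<exists>Y. sp_pregenerator Y \<and> continuous_at_zero Y \<and> laplace_dual X Y) \<longleftrightarrow>
        (\<exists>\<Sigma>\<in>spLp_nonup. \<exists>\<Sigma>'\<in>spLp_nonup. (\<forall>y\<ge>0. \<Psi> y = \<Sigma> y) \<and> (\<forall>x\<ge>0. R x = \<Sigma>' x))"
      unfolding ex classes ..
    show "\<forall>Y. sp_pregenerator Y \<and> continuous_at_zero Y \<longrightarrow>
           (laplace_dual X Y \<longleftrightarrow>
             (\<exists>\<Sigma>\<in>spLp_nonup. \<exists>\<Sigma>'\<in>spLp_nonup. (\<forall>y\<ge>0. \<Psi> y = \<Sigma> y) \<and> (\<forall>x\<ge>0. R x = \<Sigma>' x)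
                \<and> (\<forall>x>0. \<forall>y\<ge>0. Y (expo x) (ennreal y) = \<Sigma> y * L_op \<Sigma>' (expo x) (ennreal y))))"
    proof (intro allI impI iffI)
      fix Y assume Y: "?good Y" "laplace_dual X Y"
      then have "\<forall>x>0. \<forall>y\<ge>0. Y (expo x) (ennreal y) = \<Psi> y * L_op R (expo x) (ennreal y)"
        using dual_iff[OF Y(1)] by (simp add: L_op_expo_ennreal)
      then show "\<exists>\<Sigma>\<in>spLp_nonup. \<exists>\<Sigma>'\<in>spLp_nonup. (\<forall>y\<ge>0. \<Psi> y = \<Sigma> y) \<and> (\<forall>x\<ge>0. R x = \<Sigma>' x)
                \<and> (\<forall>x>0. \<forall>y\<ge>0. Y (expo x) (ennreal y) = \<Sigma> y * L_op \<Sigma>' (expo x) (ennreal y))"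
        using R[OF Y] \<Psi> by (intro bexI[of _ \<Psi>] bexI[of _ R]) simp_all
    next
      fix Y assume "?good Y" and "\<exists>\<Sigma>\<in>spLp_nonup. \<exists>\<Sigma>'\<in>spLp_nonup.
          (\<forall>y\<ge>0. \<Psi> y = \<Sigma> y) \<and> (\<forall>x\<ge>0. R x = \<Sigma>' x)
          \<and> (\<forall>x>0. \<forall>y\<ge>0. Y (expo x) (ennreal y) = \<Sigma> y * L_op \<Sigma>' (expo x) (ennreal y))"
      then show "laplace_dual X Y" unfolding dual_iff[OF \<open>?good Y\<close>] by (auto simp: L_op_expo_ennreal)
    qed
    show "\<forall>Y. sp_pregenerator Y \<and> continuous_at_zero Y \<and> laplace_dual X Y \<longrightarrow>
           (\<forall>\<Sigma>\<in>spLp_nonup. \<forall>\<Sigma>'\<in>spLp_nonup.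
              (\<forall>y\<ge>0. \<Psi> y = \<Sigma> y) \<and> (\<forall>x\<ge>0. R x = \<Sigma>' x) \<longrightarrow>
              (\<forall>x>0. \<forall>y>0. laplace_symbol X (ennreal x) y = \<Sigma>' x * \<Sigma> y
                         \<and> laplace_symbol Y (ennreal y) x = \<Sigma>' x * \<Sigma> y))"
    proof (intro allI ballI impI)
      fix Y \<Sigma> \<Sigma>' and x y :: real
      assume "sp_pregenerator Y \<and> continuous_at_zero Y \<and> laplace_dual X Y" "0 < x" "0 < y"
        and "(\<forall>y\<ge>0. \<Psi> y = \<Sigma> y) \<and> (\<forall>x\<ge>0. R x = \<Sigma>' x)"
      then show "laplace_symbol X (ennreal x) y = \<Sigma>' x * \<Sigma> y
          \<and> laplace_symbol Y (ennreal y) x = \<Sigma>' x * \<Sigma> y"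
        using symbols[of Y x y] by simp
    qed
  next
    assume nonpos: "\<forall>y\<ge>0. \<Psi> y \<le> 0"
    have ex: "(\<exists>Y. sp_pregenerator Y \<and> continuous_at_zero Y \<and> laplace_dual X Y) \<longleftrightarrow> R \<in> pk_subo"
      and \<Phi>: "(\<lambda>y. - \<Psi> y) \<in> pk_subo" and R: "?good Y \<Longrightarrow> laplace_dual X Y \<Longrightarrow> R \<in> pk_subo" for Y
      using part2[OF nonpos] unfolding conj_assoc by blast+
    have classes: "(\<exists>\<Phi>\<in>pk_subo. \<exists>\<Phi>'\<in>pk_subo. (\<forall>y\<ge>0. \<Psi> y = - \<Phi> y) \<and> (\<forall>x\<ge>0. R x = \<Phi>' x))
        \<longleftrightarrow> R \<in> pk_subo"
    proof
      show "R \<in> pk_subo" if "\<exists>\<Phi>\<in>pk_subo. \<exists>\<Phi>'\<in>pk_subo.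
          (\<forall>y\<ge>0. \<Psi> y = - \<Phi> y) \<and> (\<forall>x\<ge>0. R x = \<Phi>' x)"
        using that by (elim bexE conjE) (rule pk_subo_cong)
    qed (rule bexI[OF _ \<Phi>], rule bexI[of _ R], simp_all)
    show "(\<exists>Y. sp_pregenerator Y \<and> continuous_at_zero Y \<and> laplace_dual X Y) \<longleftrightarrow>
        (\<exists>\<Phi>\<in>pk_subo. \<exists>\<Phi>'\<in>pk_subo. (\<forall>y\<ge>0. \<Psi> y = - \<Phi> y) \<and> (\<forall>x\<ge>0. R x = \<Phi>' x))"
      unfolding ex classes ..
    show "\<forall>Y. sp_pregenerator Y \<and> continuous_at_zero Y \<longrightarrow>
           (laplace_dual X Y \<longleftrightarrow>
             (\<exists>\<Phi>\<in>pk_subo. \<exists>\<Phi>'\<in>pk_subo. (\<forall>y\<ge>0. \<Psi> y = - \<Phi> y) \<and> (\<forall>x\<ge>0. R x = \<Phi>' x)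
                \<and> (\<forall>x>0. \<forall>y\<ge>0. Y (expo x) (ennreal y)
                       = \<Phi> y * L_op (\<lambda>z. - \<Phi>' z) (expo x) (ennreal y))))"
    proof (intro allI impI iffI)
      fix Y assume Y: "?good Y" "laplace_dual X Y"
      then have "\<forall>x>0. \<forall>y\<ge>0. Y (expo x) (ennreal y)
          = - \<Psi> y * L_op (\<lambda>z. - R z) (expo x) (ennreal y)"
        using dual_iff[OF Y(1)] by (simp add: L_op_expo_ennreal)
      then show "\<exists>\<Phi>\<in>pk_subo. \<exists>\<Phi>'\<in>pk_subo. (\<forall>y\<ge>0. \<Psi> y = - \<Phi> y) \<and> (\<forall>x\<ge>0. R x = \<Phi>' x)
                \<and> (\<forall>x>0. \<forall>y\<ge>0. Y (expo x) (ennreal y)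
                       = \<Phi> y * L_op (\<lambda>z. - \<Phi>' z) (expo x) (ennreal y))"
        using R[OF Y] \<Phi> by (intro bexI[of _ "\<lambda>y. - \<Psi> y"] bexI[of _ R]) simp_all
    next
      fix Y assume "?good Y" and "\<exists>\<Phi>\<in>pk_subo. \<exists>\<Phi>'\<in>pk_subo.
          (\<forall>y\<ge>0. \<Psi> y = - \<Phi> y) \<and> (\<forall>x\<ge>0. R x = \<Phi>' x)
          \<and> (\<forall>x>0. \<forall>y\<ge>0. Y (expo x) (ennreal y)
                 = \<Phi> y * L_op (\<lambda>z. - \<Phi>' z) (expo x) (ennreal y))"
      then show "laplace_dual X Y" unfolding dual_iff[OF \<open>?good Y\<close>] by (auto simp: L_op_expo_ennreal)
    qed
    show "\<forall>Y. sp_pregenerator Y \<and> continuous_at_zero Y \<and> laplace_dual X Y \<longrightarrow>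
           (\<forall>\<Phi>\<in>pk_subo. \<forall>\<Phi>'\<in>pk_subo.
              (\<forall>y\<ge>0. \<Psi> y = - \<Phi> y) \<and> (\<forall>x\<ge>0. R x = \<Phi>' x) \<longrightarrow>
              (\<forall>x>0. \<forall>y>0. laplace_symbol X (ennreal x) y = - \<Phi>' x * \<Phi> y
                         \<and> laplace_symbol Y (ennreal y) x = - \<Phi>' x * \<Phi> y))"
    proof (intro allI ballI impI)
      fix Y \<Phi> \<Phi>' and x y :: real
      assume "sp_pregenerator Y \<and> continuous_at_zero Y \<and> laplace_dual X Y" "0 < x" "0 < y"
        and "(\<forall>y\<ge>0. \<Psi> y = - \<Phi> y) \<and> (\<forall>x\<ge>0. R x = \<Phi>' x)"
      then show "laplace_symbol X (ennreal x) y = - \<Phi>' x * \<Phi> y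
          \<and> laplace_symbol Y (ennreal y) x = - \<Phi>' x * \<Phi> y"
        using symbols[of Y x y] by simp
    qed
  next
    assume mixed: "\<not> (\<forall>y\<ge>0. 0 \<le> \<Psi> y) \<and> \<not> (\<forall>y\<ge>0. \<Psi> y \<le> 0)"
    note P = part3[OF conjunct1[OF mixed] conjunct2[OF mixed]]
    show "(\<exists>Y. sp_pregenerator Y \<and> continuous_at_zero Y \<and> laplace_dual X Y) \<longleftrightarrow>
        (\<exists>\<gamma>>0. \<forall>x\<ge>0. R x = \<gamma> * x)"
      using P by (simp only: conj_assoc)
    show "\<forall>Y. sp_pregenerator Y \<and> continuous_at_zero Y \<longrightarrow>
           (laplace_dual X Y \<longleftrightarrow>
             (\<exists>\<gamma>>0. (\<forall>x\<ge>0. R x = \<gamma> * x)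
                \<and> (\<forall>x>0. \<forall>y\<ge>0. Y (expo x) (ennreal y)
                       = - \<Psi> y * L_op (\<lambda>z. - (\<gamma> * z)) (expo x) (ennreal y))))"
    proof (intro allI impI iffI)
      fix Y assume Y: "?good Y" "laplace_dual X Y"
      then obtain \<gamma> where \<gamma>: "0 < \<gamma>" "\<forall>x\<ge>0. R x = \<gamma> * x" using P by blast
      then have "\<forall>x>0. \<forall>y\<ge>0. Y (expo x) (ennreal y)
          = - \<Psi> y * L_op (\<lambda>z. - (\<gamma> * z)) (expo x) (ennreal y)"
        using Y(2) dual_iff[OF Y(1)] by (simp add: L_op_expo_ennreal)
      with \<gamma> show "\<exists>\<gamma>>0. (\<forall>x\<ge>0. R x = \<gamma> * x)
                \<and> (\<forall>x>0. \<forall>y\<ge>0. Y (expo x) (ennreal y)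
                       = - \<Psi> y * L_op (\<lambda>z. - (\<gamma> * z)) (expo x) (ennreal y))"
        by blast
    next
      fix Y assume "?good Y" and "\<exists>\<gamma>>0. (\<forall>x\<ge>0. R x = \<gamma> * x)
          \<and> (\<forall>x>0. \<forall>y\<ge>0. Y (expo x) (ennreal y)
                 = - \<Psi> y * L_op (\<lambda>z. - (\<gamma> * z)) (expo x) (ennreal y))"
      then show "laplace_dual X Y" unfolding dual_iff[OF \<open>?good Y\<close>] by (auto simp: L_op_expo_ennreal)
    qed
    show "\<forall>Y. sp_pregenerator Y \<and> continuous_at_zero Y \<and> laplace_dual X Y \<longrightarrow>
           (\<forall>\<gamma>>0. (\<forall>x\<ge>0. R x = \<gamma> * x) \<longrightarrow>
              (\<forall>x>0. \<forall>y>0. laplace_symbol X (ennreal x) y = \<gamma> * x * \<Psi> y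
                         \<and> laplace_symbol Y (ennreal y) x = \<gamma> * x * \<Psi> y))"
    proof (intro allI impI)
      fix Y and \<gamma> x y :: real
      assume "sp_pregenerator Y \<and> continuous_at_zero Y \<and> laplace_dual X Y" "0 < x" "0 < y"
        and "\<forall>x\<ge>0. R x = \<gamma> * x"
      then show "laplace_symbol X (ennreal x) y = \<gamma> * x * \<Psi> y
          \<and> laplace_symbol Y (ennreal y) x = \<gamma> * x * \<Psi> y"
        using symbols[of Y x y] by simp
    qed
  qed
qed

end
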